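(* The $\mathbb{F}$-algebra $U^{\vee}_q$ has a presentation by generators $z,Z,A$ and relations $$\frac{qzA-q^{-1}Az}{q-q^{-1}} = a z^2+a^{-1},\qquad \frac{qZA-q^{-1}AZ}{q-q^{-1}} = a^{-1} Z^2+a,$$ $$a z^2 -\frac{a^{-1}q-aq^{-1}}{q-q^{-1}}zZ-\frac{aq-a^{-1}q^{-1}}{q-q^{-1}}Zz + a^{-1}Z^2 = 0.$$ An isomorphism from this presentation to the presentation of $U^\vee_q$ by generators $x,y^{-1},z$ and relations $$\frac{qy^{-1}x-q^{-1}xy^{-1}}{q-q^{-1}} = y^{-2},\qquad \frac{qzy^{-1}-q^{-1}y^{-1}z}{q-q^{-1}} = y^{-2},\qquad \frac{qzx-q^{-1}xz}{q-q^{-1}} = 1$$ sends $$z \mapsto z,\qquad Z \mapsto a^2 z + (1-a^2)y^{-1},\qquad A \mapsto a^{-1}x+az.$$ The inverse isomorphism sends $$x \mapsto aA-a^{2}z,\qquad y^{-1} \mapsto \frac{az-a^{-1}Z}{a-a^{-1}},\qquad z \mapsto z.$$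
   Context: Algebras are associative with $1$, and a subalgebra has the same $1$ as the parent algebra. $\mathbb{F}$ is a field, $q\in\mathbb{F}$ is nonzero with $q^4\neq 1$, and $a\in\mathbb{F}$ is nonzero with $a^2\neq 1$. $U_q(\mathfrak{sl}_2)$ is the $\mathbb{F}$-algebra with generators $x,y^{\pm1},z$ and relations $yy^{-1}=y^{-1}y=1$, $$\frac{qxy-q^{-1}yx}{q-q^{-1}} = 1,\qquad \frac{qyz-q^{-1}zy}{q-q^{-1}} = 1,\qquad \frac{qzx-q^{-1}xz}{q-q^{-1}} = 1$$ (the equitable presentation). $U^\vee_q$ is the subalgebra of $U_q(\mathfrak{sl}_2)$ generated by $x,y^{-1},z$. In $U^\vee_q$ the elements $Z,A$ are $Z=a^2z+(1-a^2)y^{-1}$ and $A=a^{-1}x+az$. The displayed relations in $x,y^{-1},z$ do give a presentation of $U^\vee_q$. *)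

theory Defs
  imports "HOL-Library.Poly_Mapping" "HOL-Algebra.Algebra"
begin

text \<open>
  Words are lists. Viewing them as the free monoid (written additively, as \<^theory>\<open>HOL-Library.Poly_Mapping\<close>
  requires), the type of finitely supported functions on words, with its convolution product, is
  the free associative unital algebra.
\<close>

instantiation list :: (type) monoid_add
begin
definition zero_list :: "'a list" where "zero_list = []"
definition plus_list :: "'a list \<Rightarrow> 'a list \<Rightarrow> 'a list" where "plus_list u v = u @ v"
instance by standard (simp_all add: zero_list_def plus_list_def)
end

type_synonym ('f, 'g) falg = "'g list \<Rightarrow>\<^sub>0 'f"

definition scale :: "'f::field \<Rightarrow> ('f, 'g) falg \<Rightarrow> ('f, 'g) falg" (infixr "*\<^sub>F" 75)
  where "c *\<^sub>F p = Poly_Mapping.map ((*) c) p"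

definition var :: "'g \<Rightarrow> ('f::field, 'g) falg"
  where "var g = Poly_Mapping.single [g] 1"

text \<open>
  Algebras are records of type \<^typ>\<open>('f, 'a) module\<close>: a ring together with a scalar multiplication by
  elements of the field \<open>'f\<close>. The locale \<^locale>\<open>algebra\<close> of the library is not used, since it demands
  commutativity.
\<close>

definition free_algebra :: "('f::field, ('f, 'g) falg) module"
  where "free_algebra =
    \<lparr>carrier = UNIV, monoid.mult = (*), one = 1, ring.zero = 0, add = (+), smult = (*\<^sub>F)\<rparr>"

text \<open>
  The ring \<open>R Quot I\<close>, with the induced scalar multiplication. The latter has the same form as
  the library's multiplication of cosets.
\<close>

definition quot_algebra :: "('f, 'a) module \<Rightarrow> 'a set \<Rightarrow> ('f, 'a set) module"
  where "quot_algebra R I =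
    ring.extend (R Quot I) (module.fields (\<lambda>c C. \<Union>x\<in>C. I +>\<^bsub>R\<^esub> (c \<odot>\<^bsub>R\<^esub> x)))"

text \<open>
  A relation \<open>l = r\<close> between elements of the free algebra is encoded as the pair \<open>(l, r)\<close>.
  The library's \<^const>\<open>genideal\<close> gives the two-sided ideal generated by a set.
\<close>

definition rel_ideal :: "(('f::field, 'g) falg \<times> ('f, 'g) falg) set \<Rightarrow> ('f, 'g) falg set"
  where "rel_ideal R = Idl\<^bsub>free_algebra\<^esub> {l - r | l r. (l, r) \<in> R}"

definition presented ::
    "(('f::field, 'g) falg \<times> ('f, 'g) falg) set \<Rightarrow> ('f, ('f, 'g) falg set) module"
  where "presented R = quot_algebra free_algebra (rel_ideal R)"

definition cls ::
    "(('f::field, 'g) falg \<times> ('f, 'g) falg) set \<Rightarrow> ('f, 'g) falg \<Rightarrow> ('f, 'g) falg set"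
  where "cls R p = rel_ideal R +>\<^bsub>free_algebra\<^esub> p"

definition pgen :: "(('f::field, 'g) falg \<times> ('f, 'g) falg) set \<Rightarrow> 'g \<Rightarrow> ('f, 'g) falg set"
  where "pgen R g = cls R (var g)"

definition alg_iso :: "('f, 'a) module \<Rightarrow> ('f, 'b) module \<Rightarrow> ('a \<Rightarrow> 'b) set"
  where "alg_iso A B = {h \<in> ring_iso A B.
    \<forall>c. \<forall>x \<in> carrier A. h (c \<odot>\<^bsub>A\<^esub> x) = c \<odot>\<^bsub>B\<^esub> h x}"

text \<open>The algebra \<open>B\<close> has a presentation by generators \<open>e g\<close> and relations \<open>R\<close>.\<close>

definition has_presentation ::
    "('f::field, 'b) module \<Rightarrow> ('g \<Rightarrow> 'b) \<Rightarrow> (('f, 'g) falg \<times> ('f, 'g) falg) set \<Rightarrow> bool"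
  where "has_presentation B e R \<longleftrightarrow>
    (\<exists>h \<in> alg_iso (presented R) B. \<forall>g. h (pgen R g) = e g)"

definition is_subalgebra :: "'a set \<Rightarrow> ('f, 'a) module \<Rightarrow> bool"
  where "is_subalgebra S A \<longleftrightarrow> subring S A \<and> (\<forall>c. \<forall>x \<in> S. c \<odot>\<^bsub>A\<^esub> x \<in> S)"

definition generated_subalgebra :: "('f, 'a) module \<Rightarrow> 'a set \<Rightarrow> ('f, 'a) module"
  where "generated_subalgebra A G = A\<lparr>carrier := \<Inter>{S. is_subalgebra S A \<and> G \<subseteq> S}\<rparr>"

definition qbr :: "'f::field \<Rightarrow> ('f, 'g) falg \<Rightarrow> ('f, 'g) falg \<Rightarrow> ('f, 'g) falg"
  where "qbr q u v = (1 / (q - inverse q)) *\<^sub>F (q *\<^sub>F (u * v) - inverse q *\<^sub>F (v * u))"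

text \<open>The algebra $U_q(\mathfrak{sl}_2)$ in its equitable presentation.\<close>

datatype uq_gen = Ux | Uy | Uyinv | Uz

definition uq_rels :: "'f::field \<Rightarrow> (('f, uq_gen) falg \<times> ('f, uq_gen) falg) set"
  where "uq_rels q =
    {(var Uy * var Uyinv, 1),
     (var Uyinv * var Uy, 1),
     (qbr q (var Ux) (var Uy), 1),
     (qbr q (var Uy) (var Uz), 1),
     (qbr q (var Uz) (var Ux), 1)}"

definition Uq :: "'f::field \<Rightarrow> ('f, ('f, uq_gen) falg set) module"
  where "Uq q = presented (uq_rels q)"

definition uq_x where "uq_x q = pgen (uq_rels q) Ux"
definition uq_yinv where "uq_yinv q = pgen (uq_rels q) Uyinv"
definition uq_z where "uq_z q = pgen (uq_rels q) Uz"

definition Uq_vee :: "'f::field \<Rightarrow> ('f, ('f, uq_gen) falg set) module"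
  where "Uq_vee q = generated_subalgebra (Uq q) {uq_x q, uq_yinv q, uq_z q}"

definition uq_Z :: "'f::field \<Rightarrow> 'f \<Rightarrow> ('f, uq_gen) falg set"
  where "uq_Z q a = (a^2 \<odot>\<^bsub>Uq_vee q\<^esub> uq_z q) \<oplus>\<^bsub>Uq_vee q\<^esub> ((1 - a^2) \<odot>\<^bsub>Uq_vee q\<^esub> uq_yinv q)"

definition uq_A :: "'f::field \<Rightarrow> 'f \<Rightarrow> ('f, uq_gen) falg set"
  where "uq_A q a = (inverse a \<odot>\<^bsub>Uq_vee q\<^esub> uq_x q) \<oplus>\<^bsub>Uq_vee q\<^esub> (a \<odot>\<^bsub>Uq_vee q\<^esub> uq_z q)"

datatype vee_gen = Vx | Vyinv | Vz

definition vee_rels :: "'f::field \<Rightarrow> (('f, vee_gen) falg \<times> ('f, vee_gen) falg) set"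
  where "vee_rels q =
    {(qbr q (var Vyinv) (var Vx), var Vyinv ^ 2),
     (qbr q (var Vz) (var Vyinv), var Vyinv ^ 2),
     (qbr q (var Vz) (var Vx), 1)}"

datatype zZA_gen = Gz | GZ | GA

definition zZA_rels :: "'f::field \<Rightarrow> 'f \<Rightarrow> (('f, zZA_gen) falg \<times> ('f, zZA_gen) falg) set"
  where "zZA_rels q a =
    {(qbr q (var Gz) (var GA), a *\<^sub>F var Gz ^ 2 + inverse a *\<^sub>F 1),
     (qbr q (var GZ) (var GA), inverse a *\<^sub>F var GZ ^ 2 + a *\<^sub>F 1),
     (a *\<^sub>F var Gz ^ 2
        - ((inverse a * q - a * inverse q) / (q - inverse q)) *\<^sub>F (var Gz * var GZ)
        - ((a * q - inverse a * inverse q) / (q - inverse q)) *\<^sub>F (var GZ * var Gz)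
        + inverse a *\<^sub>F var GZ ^ 2, 0)}"

end

theory Submission
  imports Defs
begin

text \<open>
  Writing \<open>y'\<close> for \<open>y\<^sup>-\<^sup>1\<close>, the substitution \<open>Z = a\<^sup>2 z + (1 - a\<^sup>2) y'\<close>, \<open>A = a\<^sup>-\<^sup>1 x + a z\<close> is linear and
  invertible, and it turns each of the three relations in \<open>z, Z, A\<close> into a linear combination of the
  three relations in \<open>x, y', z\<close>; this linear system is triangular with nonzero diagonal, so the two
  presentations agree.

  That the relations in \<open>x, y', z\<close> present the subalgebra, and not just a cover of it, is shown with a
  representation of \<open>U\<^sub>q\<close>. Put \<open>p = q\<^sup>-\<^sup>2\<close>, \<open>X = x - y'\<close>, \<open>W = z - y'\<close>. The relations become
  \<open>y' X = p X y'\<close>, \<open>W y' = p y' W\<close>, \<open>W X = p X W + (1 - p) (1 - y' y')\<close>, so the monomials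
  \<open>X\<^sup>i y'\<^sup>j W\<^sup>k\<close> span, and left multiplication on formal monomials with \<open>j\<close> ranging over the integers
  makes sense and inverts \<open>y'\<close>. An element of the kernel of the map to \<open>U\<^sub>q\<close> annihilates the vector
  \<open>1\<close> of this representation, whereas it sends \<open>1\<close> to its own expansion in the monomials, so it is zero.
\<close>

section \<open>Linear maps between spaces of finitely supported functions\<close>

text \<open>The scalar multiplication \<^const>\<open>scale\<close> is only available on functions on words.\<close>

definition smul :: "'f::field \<Rightarrow> ('k \<Rightarrow>\<^sub>0 'f) \<Rightarrow> ('k \<Rightarrow>\<^sub>0 'f)"
  where "smul c p = Poly_Mapping.map ((*) c) p"

lemma scale_eq_smul: "c *\<^sub>F p = smul c p"
  by (simp add: scale_def smul_def)

lemma lookup_smul: "Poly_Mapping.lookup (smul c p) k = c * Poly_Mapping.lookup p k"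
  unfolding smul_def by transfer (simp add: when_def)

interpretation smul: vector_space smul
  by unfold_locales (auto intro!: poly_mapping_eqI simp: lookup_smul lookup_add algebra_simps)

lemma smul_single [simp]: "smul c (Poly_Mapping.single k d) = Poly_Mapping.single k (c * d)"
  by (rule poly_mapping_eqI) (simp add: lookup_smul lookup_single when_def)

definition linear_op :: "(('k \<Rightarrow>\<^sub>0 'f::field) \<Rightarrow> ('l \<Rightarrow>\<^sub>0 'f)) \<Rightarrow> bool"
  where "linear_op f \<longleftrightarrow> (\<forall>x y. f (x + y) = f x + f y) \<and> (\<forall>c x. f (smul c x) = smul c (f x))"

lemma linear_opI:
  "\<lbrakk>\<And>x y. f (x + y) = f x + f y; \<And>c x. f (smul c x) = smul c (f x)\<rbrakk> \<Longrightarrow> linear_op f"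
  by (simp add: linear_op_def)

lemma linear_op_add: "linear_op f \<Longrightarrow> f (x + y) = f x + f y"
  and linear_op_smul: "linear_op f \<Longrightarrow> f (smul c x) = smul c (f x)"
  by (simp_all add: linear_op_def)

lemma linear_op_zero: "linear_op f \<Longrightarrow> f 0 = 0"
  using linear_op_smul[of f 0 0] by simp

lemma linear_op_diff: "linear_op f \<Longrightarrow> f (x - y) = f x - f y"
  using linear_op_add[of f "x - y" y] by (simp add: eq_diff_eq)

lemma linear_op_single: "linear_op f \<Longrightarrow> f (Poly_Mapping.single k c) = smul c (f (Poly_Mapping.single k 1))"
  by (metis linear_op_smul mult.right_neutral smul_single)

lemma poly_mapping_sum_singles: "(\<Sum>k\<in>Poly_Mapping.keys p. Poly_Mapping.single k (Poly_Mapping.lookup p k)) = p"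
  by (rule poly_mapping_eqI)
    (auto simp: lookup_sum lookup_single when_def in_keys_iff sum.delta)

text \<open>A finitely supported function is the sum of its singles. The set \<open>K\<close> keeps
  the induction inside a coordinate subspace: \<open>nonneg_keys\<close> for monomials,
  \<open>UNIV\<close> elsewhere.\<close>

lemma poly_mapping_induct_single [consumes 1, case_names zero single add]:
  fixes p :: "'k \<Rightarrow>\<^sub>0 'f::comm_monoid_add"
  assumes "Poly_Mapping.keys p \<subseteq> K" "P 0" "\<And>k c. k \<in> K \<Longrightarrow> P (Poly_Mapping.single k c)"
    "\<And>x y. P x \<Longrightarrow> P y \<Longrightarrow> P (x + y)"
  shows "P p"
proof -
  have "P (\<Sum>k\<in>A. Poly_Mapping.single k (Poly_Mapping.lookup p k))" if "A \<subseteq> K" for A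
    using that by (induction A rule: infinite_finite_induct) (auto simp: assms)
  with assms(1) show ?thesis
    by (metis poly_mapping_sum_singles)
qed

lemma linear_op_ext:
  assumes "linear_op f" "linear_op g" "\<And>k. f (Poly_Mapping.single k 1) = g (Poly_Mapping.single k 1)"
  shows "f p = g p"
  using subset_UNIV[of "Poly_Mapping.keys p"]
proof (induction rule: poly_mapping_induct_single)
  case (single k c)
  then show ?case
    by (metis assms linear_op_single)
qed (simp_all add: assms linear_op_zero linear_op_add)

definition lin_ext :: "('k \<Rightarrow> ('l \<Rightarrow>\<^sub>0 'f::field)) \<Rightarrow> ('k \<Rightarrow>\<^sub>0 'f) \<Rightarrow> ('l \<Rightarrow>\<^sub>0 'f)"
  where "lin_ext f p = (\<Sum>k\<in>Poly_Mapping.keys p. smul (Poly_Mapping.lookup p k) (f k))"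

lemma lin_ext_superset:
  assumes "finite A" "Poly_Mapping.keys p \<subseteq> A"
  shows "lin_ext f p = (\<Sum>k\<in>A. smul (Poly_Mapping.lookup p k) (f k))"
  unfolding lin_ext_def using assms
  by (intro sum.mono_neutral_left) (auto simp: in_keys_iff)

lemma lin_ext_single [simp]: "lin_ext f (Poly_Mapping.single k c) = smul c (f k)"
  by (subst lin_ext_superset[of "{k}"]) auto

lemma linear_op_lin_ext: "linear_op (lin_ext f)"
proof (rule linear_opI)
  fix x y :: "'a \<Rightarrow>\<^sub>0 'b"
  have "Poly_Mapping.keys (x + y) \<subseteq> Poly_Mapping.keys x \<union> Poly_Mapping.keys y" by (rule keys_add)
  then show "lin_ext f (x + y) = lin_ext f x + lin_ext f y"
    by (simp add: lin_ext_superset[of "Poly_Mapping.keys x \<union> Poly_Mapping.keys y"] lookup_add smul.scale_left_distrib sum.distrib)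
next
  fix c and x :: "'a \<Rightarrow>\<^sub>0 'b"
  have "Poly_Mapping.keys (smul c x) \<subseteq> Poly_Mapping.keys x" by (auto simp: in_keys_iff lookup_smul)
  then show "lin_ext f (smul c x) = smul c (lin_ext f x)"
    by (simp add: lin_ext_superset[of "Poly_Mapping.keys x"] lookup_smul smul.scale_sum_right)
qed

lemma linear_op_id: "linear_op (\<lambda>x. x)"
  by (simp add: linear_op_def)

lemma linear_op_compose: "linear_op f \<Longrightarrow> linear_op g \<Longrightarrow> linear_op (\<lambda>x. f (g x))"
  by (simp add: linear_op_def)

lemma linear_op_plus: "linear_op f \<Longrightarrow> linear_op g \<Longrightarrow> linear_op (\<lambda>x. f x + g x)"
  and linear_op_minus: "linear_op f \<Longrightarrow> linear_op g \<Longrightarrow> linear_op (\<lambda>x. f x - g x)"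
  and linear_op_scale: "linear_op f \<Longrightarrow> linear_op (\<lambda>x. smul c (f x))"
  by (auto simp: linear_op_def smul.scale_right_distrib smul.scale_right_diff_distrib mult.commute)

section \<open>Free algebras\<close>

text \<open>Here \<open>0\<close> is the empty word, so scalars act as multiplication by constants.
  Hence a two-sided ideal is closed under scalars (\<open>rel_ideal_smul\<close>).\<close>

lemma smul_eq_mult: "smul c p = Poly_Mapping.single 0 c * p" for p :: "('f::field, 'g) falg"
  by (simp add: smul_def mult_map_scale_conv_mult)

lemma mult_smul_left [simp]: "smul c p * r = smul c (p * r)" for p :: "('f::field, 'g) falg"
  by (simp add: smul_eq_mult mult.assoc)

lemma linear_op_mult_left: "linear_op (\<lambda>r. p * r)" for p :: "('f::field, 'g) falg"
proof -
  have comm: "p * Poly_Mapping.single 0 c = Poly_Mapping.single 0 c * p" for c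
    using subset_UNIV[of "Poly_Mapping.keys p"]
    by (induction rule: poly_mapping_induct_single) (simp_all add: mult_single algebra_simps)
  show ?thesis
    by (rule linear_opI) (simp_all add: algebra_simps smul_eq_mult flip: mult.assoc comm)
qed

lemma mult_smul_right [simp]: "p * smul c r = smul c (p * r)" for p :: "('f::field, 'g) falg"
  using linear_op_mult_left by (rule linear_op_smul)

lemma single_Nil: "Poly_Mapping.single [] 1 = (1 :: ('f::field, 'g) falg)"
  by (metis single_one zero_list_def)

lemma single_Cons: "Poly_Mapping.single (g # v) 1 = var g * (Poly_Mapping.single v 1 :: ('f::field, 'g) falg)"
  by (simp add: var_def mult_single plus_list_def)

text \<open>Words span the free algebra and arise from the empty word by prepending letters, so left
  multiplication by a generator is the only product to treat.\<close>

lemma falg_induct [case_names zero one add smul var]: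
  fixes p :: "('f::field, 'g) falg"
  assumes "P 0" "P 1" "\<And>x y. P x \<Longrightarrow> P y \<Longrightarrow> P (x + y)" "\<And>c x. P x \<Longrightarrow> P (smul c x)"
    "\<And>g x. P x \<Longrightarrow> P (var g * x)"
  shows "P p"
proof -
  have word: "P (Poly_Mapping.single v 1)" for v
    by (induction v) (simp_all add: single_Nil single_Cons assms)
  from subset_UNIV[of "Poly_Mapping.keys p"] show ?thesis
  proof (induction rule: poly_mapping_induct_single)
    case (single v c)
    then show ?case
      using assms(4)[OF word, of c v] by simp
  qed (fact assms)+
qed

section \<open>Actions of a free algebra by linear operators\<close>

definition act :: "('g \<Rightarrow> ('k \<Rightarrow>\<^sub>0 'f) \<Rightarrow> ('k \<Rightarrow>\<^sub>0 'f)) \<Rightarrow> ('f::field, 'g) falg \<Rightarrow> ('k \<Rightarrow>\<^sub>0 'f) \<Rightarrow> ('k \<Rightarrow>\<^sub>0 'f)"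
  where "act \<rho> p m = lin_ext (\<lambda>v. foldr \<rho> v m) p"

lemma act_add: "act \<rho> (p + r) m = act \<rho> p m + act \<rho> r m"
  and act_diff: "act \<rho> (p - r) m = act \<rho> p m - act \<rho> r m"
  and act_smul: "act \<rho> (smul c p) m = smul c (act \<rho> p m)"
  and act_zero: "act \<rho> 0 m = 0"
  unfolding act_def using linear_op_lin_ext[of "\<lambda>v. foldr \<rho> v m"]
  by (simp_all add: linear_op_add linear_op_diff linear_op_smul linear_op_zero)

lemma act_one: "act \<rho> 1 m = m"
  and act_var: "act \<rho> (var g) m = \<rho> g m"
  by (simp_all add: act_def var_def flip: single_Nil)

lemma act_var_mult:
  assumes "\<And>g. linear_op (\<rho> g)"
  shows "act \<rho> (var g * p) m = \<rho> g (act \<rho> p m)"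
proof (rule linear_op_ext[of "\<lambda>p. act \<rho> (var g * p) m"])
  have act: "linear_op (\<lambda>p. act \<rho> p m)"
    unfolding act_def by (rule linear_op_lin_ext)
  show "linear_op (\<lambda>p. act \<rho> (var g * p) m)"
    by (rule linear_op_compose[OF act linear_op_mult_left])
  show "linear_op (\<lambda>p. \<rho> g (act \<rho> p m))"
    by (rule linear_op_compose[OF assms act])
  show "act \<rho> (var g * Poly_Mapping.single v 1) m = \<rho> g (act \<rho> (Poly_Mapping.single v 1) m)" for v
    by (simp add: act_def flip: single_Cons)
qed

lemma act_mult:
  assumes "\<And>g. linear_op (\<rho> g)"
  shows "act \<rho> (p * r) m = act \<rho> p (act \<rho> r m)"
  by (induction p rule: falg_induct)
    (simp_all add: act_zero act_one act_add act_smul act_var_mult assms distrib_right mult.assoc)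

lemma linear_op_act:
  assumes "\<And>g. linear_op (\<rho> g)"
  shows "linear_op (act \<rho> p)"
proof (rule linear_opI)
  show "act \<rho> p (x + y) = act \<rho> p x + act \<rho> p y" for x y
    by (induction p rule: falg_induct)
      (simp_all add: act_zero act_one act_add act_smul act_var_mult assms linear_op_add
        smul.scale_right_distrib)
  show "act \<rho> p (smul c x) = smul c (act \<rho> p x)" for c x
    by (induction p rule: falg_induct)
      (simp_all add: act_zero act_one act_add act_smul act_var_mult assms linear_op_smul
        smul.scale_right_distrib mult.commute)
qed

section \<open>Substitution homomorphisms between free algebras\<close>

text \<open>Obtained as the action by left multiplications applied to \<open>1\<close>, so that the
  laws of \<open>act\<close> carry over.\<close>

definition subst :: "('g \<Rightarrow> ('f::field, 'h) falg) \<Rightarrow> ('f, 'g) falg \<Rightarrow> ('f, 'h) falg"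
  where "subst \<sigma> p = act (\<lambda>g m. \<sigma> g * m) p 1"

lemma subst_add: "subst \<sigma> (p + r) = subst \<sigma> p + subst \<sigma> r"
  and subst_diff: "subst \<sigma> (p - r) = subst \<sigma> p - subst \<sigma> r"
  and subst_smul: "subst \<sigma> (smul c p) = smul c (subst \<sigma> p)"
  and subst_zero: "subst \<sigma> 0 = 0"
  and subst_one: "subst \<sigma> 1 = 1"
  and subst_var: "subst \<sigma> (var g) = \<sigma> g"
  by (simp_all add: subst_def act_add act_diff act_smul act_zero act_one act_var)

lemma subst_mult: "subst \<sigma> (p * r) = subst \<sigma> p * subst \<sigma> r"
proof -
  \<comment> \<open>Left and right multiplications commute, so acting on \<open>m\<close> is acting
    on \<open>1\<close> and then multiplying by \<open>m\<close> from the right.\<close>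
  have "act (\<lambda>g m. \<sigma> g * m) p m = act (\<lambda>g m. \<sigma> g * m) p 1 * m" for m
    by (induction p rule: falg_induct)
      (simp_all add: act_zero act_one act_add act_smul act_var_mult linear_op_mult_left distrib_right mult.assoc)
  from this[of "subst \<sigma> r"] show ?thesis
    unfolding subst_def by (simp add: act_mult linear_op_mult_left)
qed

lemmas subst_simps = subst_add subst_diff subst_smul subst_zero subst_one subst_var subst_mult

text \<open>Pulls a representation back along a substitution. With \<open>iota\<close>, a
  representation of U_q is restricted to words in x, y^-1, z.\<close>

lemma act_subst:
  assumes "\<And>g. linear_op (\<rho> g)"
  shows "act \<rho> (subst \<sigma> p) m = act (\<lambda>g. act \<rho> (\<sigma> g)) p m"
  by (induction p rule: falg_induct)
    (simp_all add: subst_simps act_zero act_one act_add act_smul act_var act_var_mult linear_op_act act_mult assms)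

lemma subst_subst: "subst \<tau> (subst \<sigma> p) = subst (\<lambda>g. subst \<tau> (\<sigma> g)) p"
  by (induction p rule: falg_induct) (simp_all add: subst_simps)

lemma subst_ident: "subst var p = p"
  by (induction p rule: falg_induct) (simp_all add: subst_simps)

section \<open>Presented algebras\<close>

lemma free_algebra_simps [simp]:
  "carrier free_algebra = UNIV" "x \<otimes>\<^bsub>free_algebra\<^esub> y = x * y" "\<one>\<^bsub>free_algebra\<^esub> = 1"
  "\<zero>\<^bsub>free_algebra\<^esub> = 0" "x \<oplus>\<^bsub>free_algebra\<^esub> y = x + y" "c \<odot>\<^bsub>free_algebra\<^esub> x = smul c x"
  by (simp_all add: free_algebra_def scale_eq_smul)

lemma ring_free_algebra: "ring (free_algebra :: ('f::field, ('f, 'g) falg) module)"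
proof (rule ringI)
  show "abelian_group (free_algebra :: ('f, ('f, 'g) falg) module)"
    by (rule abelian_groupI) (auto simp: algebra_simps intro: exI[of _ "- _"])
  show "Group.monoid (free_algebra :: ('f, ('f, 'g) falg) module)"
    by (rule monoidI) (auto simp: algebra_simps)
qed (auto simp: algebra_simps)

lemma ideal_rel_ideal: "ideal (rel_ideal R) free_algebra"
  unfolding rel_ideal_def by (rule ring.genideal_ideal[OF ring_free_algebra]) simp

lemma rel_ideal_gen: "(l, r) \<in> R \<Longrightarrow> l - r \<in> rel_ideal R"
  unfolding rel_ideal_def using ring.genideal_self[OF ring_free_algebra] by fastforce

lemma rel_ideal_zero: "0 \<in> rel_ideal R"
  and rel_ideal_add: "x \<in> rel_ideal R \<Longrightarrow> y \<in> rel_ideal R \<Longrightarrow> x + y \<in> rel_ideal R"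
  and rel_ideal_mult_left: "x \<in> rel_ideal R \<Longrightarrow> u * x \<in> rel_ideal R"
  and rel_ideal_mult_right: "x \<in> rel_ideal R \<Longrightarrow> x * u \<in> rel_ideal R"
proof -
  interpret ideal "rel_ideal R" free_algebra by (rule ideal_rel_ideal)
  show "0 \<in> rel_ideal R"
    using additive_subgroup.zero_closed[OF is_additive_subgroup] by simp
  show "x \<in> rel_ideal R \<Longrightarrow> y \<in> rel_ideal R \<Longrightarrow> x + y \<in> rel_ideal R"
    using additive_subgroup.a_closed[OF is_additive_subgroup, of x y] by simp
  show "x \<in> rel_ideal R \<Longrightarrow> u * x \<in> rel_ideal R" "x \<in> rel_ideal R \<Longrightarrow> x * u \<in> rel_ideal R"
    using I_l_closed[of x u] I_r_closed[of x u] by simp_all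
qed

lemma rel_ideal_smul: "x \<in> rel_ideal R \<Longrightarrow> smul c x \<in> rel_ideal R"
  by (simp add: smul_eq_mult rel_ideal_mult_left)

lemma rel_ideal_uminus: "x \<in> rel_ideal R \<Longrightarrow> - x \<in> rel_ideal R"
  using rel_ideal_mult_left[of x R "-1"] by simp

lemma rel_ideal_diff: "x \<in> rel_ideal R \<Longrightarrow> y \<in> rel_ideal R \<Longrightarrow> x - y \<in> rel_ideal R"
  using rel_ideal_add[of x R "- y"] rel_ideal_uminus[of y R] by simp

text \<open>The elements satisfying \<open>P\<close> form a two-sided ideal containing the
  generators; negatives come from multiplying by \<open>-1\<close>.\<close>

lemma rel_ideal_induct [consumes 1, case_names gen zero add left right]:
  fixes p :: "('f::field, 'g) falg"
  assumes "p \<in> rel_ideal R" "\<And>l r. (l, r) \<in> R \<Longrightarrow> P (l - r)" "P 0"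
    "\<And>x y. P x \<Longrightarrow> P y \<Longrightarrow> P (x + y)" "\<And>u x. P x \<Longrightarrow> P (u * x)" "\<And>u x. P x \<Longrightarrow> P (x * u)"
  shows "P p"
proof -
  interpret F: ring "free_algebra :: ('f, ('f, 'g) falg) module" by (rule ring_free_algebra)
  have "ideal {p. P p} (free_algebra :: ('f, ('f, 'g) falg) module)"
  proof (rule idealI[OF ring_free_algebra])
    show "subgroup {p. P p} (add_monoid (free_algebra :: ('f, ('f, 'g) falg) module))"
    proof (rule F.add.subgroupI)
      fix x :: "('f, 'g) falg"
      assume "x \<in> {p. P p}"
      then have "P (- x)" using assms(5)[of x "-1"] by simp
      moreover have "\<ominus>\<^bsub>free_algebra :: ('f, ('f, 'g) falg) module\<^esub> x = - x"
        by (rule F.minus_equality) auto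
      ultimately show "\<ominus>\<^bsub>free_algebra :: ('f, ('f, 'g) falg) module\<^esub> x \<in> {p. P p}"
        by simp
    qed (use assms in auto)
  qed (use assms in auto)
  then have "rel_ideal R \<subseteq> {p. P p}"
    unfolding rel_ideal_def by (rule F.genideal_minimal) (use assms in auto)
  with assms(1) show ?thesis by auto
qed

lemma cls_eq_iff:
  fixes p :: "('f::field, 'g) falg"
  shows "cls R p = cls R r \<longleftrightarrow> p - r \<in> rel_ideal R"
proof -
  interpret F: ring "free_algebra :: ('f, ('f, 'g) falg) module" by (rule ring_free_algebra)
  have m: "\<ominus>\<^bsub>free_algebra\<^esub> x = - x" for x :: "('f, 'g) falg"
    by (rule F.minus_equality) auto
  show ?thesis
    using F.quotient_eq_iff_same_a_r_cos[OF ideal_rel_ideal[of R], of p r]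
    by (simp add: cls_def a_minus_def m)
qed

lemma presented_simps:
  "carrier (presented R) = range (cls R)"
  "\<one>\<^bsub>presented R\<^esub> = cls R 1"
  "\<zero>\<^bsub>presented R\<^esub> = cls R 0"
  "cls R p \<otimes>\<^bsub>presented R\<^esub> cls R r = cls R (p * r)"
  "cls R p \<oplus>\<^bsub>presented R\<^esub> cls R r = cls R (p + r)"
proof -
  interpret ideal "rel_ideal R" free_algebra by (rule ideal_rel_ideal)
  note defs = presented_def quot_algebra_def ring.defs module.defs FactRing_def cls_def
  show "carrier (presented R) = range (cls R)"
    by (auto simp: defs A_RCOSETS_defs a_r_coset_def)
  show "\<one>\<^bsub>presented R\<^esub> = cls R 1"
    by (simp add: defs)
  show "\<zero>\<^bsub>presented R\<^esub> = cls R 0"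
    using a_rcos_zero[OF ideal_rel_ideal rel_ideal_zero, of R] by (simp add: defs)
  show "cls R p \<otimes>\<^bsub>presented R\<^esub> cls R r = cls R (p * r)"
    using rcoset_mult_add[of p r] by (simp add: defs)
  show "cls R p \<oplus>\<^bsub>presented R\<^esub> cls R r = cls R (p + r)"
    using a_rcos_sum[of p r] by (simp add: defs)
qed

lemma mem_cls_iff: "x \<in> cls R p \<longleftrightarrow> x - p \<in> rel_ideal R"
  by (auto simp: cls_def a_r_coset_def' intro: bexI[of _ "x - p"])

text \<open>The union in \<open>quot_algebra\<close> collapses: the ideal is closed under scalars,
  so all representatives contribute the same coset, and \<open>p\<close> is one of them.\<close>

lemma presented_smult: "c \<odot>\<^bsub>presented R\<^esub> cls R p = cls R (smul c p)"
proof -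
  have "c \<odot>\<^bsub>presented R\<^esub> cls R p = (\<Union>x\<in>cls R p. cls R (smul c x))"
    by (simp add: presented_def quot_algebra_def ring.defs module.defs cls_def)
  also have "\<dots> = (\<Union>x\<in>cls R p. cls R (smul c p))"
    by (rule SUP_cong)
      (auto simp: cls_eq_iff mem_cls_iff rel_ideal_smul simp flip: smul.scale_right_diff_distrib)
  also have "\<dots> = cls R (smul c p)"
  proof -
    have "p \<in> cls R p"
      by (simp add: mem_cls_iff rel_ideal_zero)
    then show ?thesis by auto
  qed
  finally show ?thesis .
qed

lemma ring_presented: "ring (presented R)"
proof (rule ringI)
  have "cls R (- p) \<oplus>\<^bsub>presented R\<^esub> cls R p = cls R 0" for p
    by (simp add: presented_simps)
  then show "abelian_group (presented R)"
    by (intro abelian_groupI) (auto simp: presented_simps algebra_simps simp del: presented_simps(5), (simp add: presented_simps algebra_simps)+)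
  show "Group.monoid (presented R)"
    by (rule monoidI) (auto simp: presented_simps mult.assoc)
qed (auto simp: presented_simps algebra_simps)

lemma presented_minus: "cls R p \<ominus>\<^bsub>presented R\<^esub> cls R r = cls R (p - r)"
proof -
  interpret ring "presented R" by (rule ring_presented)
  have "\<ominus>\<^bsub>presented R\<^esub> cls R r = cls R (- r)"
    by (rule minus_equality) (auto simp: presented_simps)
  then show ?thesis
    by (simp add: a_minus_def presented_simps)
qed

section \<open>Maps of presented algebras induced by substitutions\<close>

text \<open>The value is taken at a chosen representative; by \<open>lift_subst_cls\<close> the
  choice is immaterial once \<open>\<sigma>\<close> respects the relations.\<close>

definition lift_subst ::
    "(('f::field, 'g) falg \<times> ('f, 'g) falg) set \<Rightarrow> (('f, 'h) falg \<times> ('f, 'h) falg) set \<Rightarrow>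
     ('g \<Rightarrow> ('f, 'h) falg) \<Rightarrow> ('f, 'g) falg set \<Rightarrow> ('f, 'h) falg set"
  where "lift_subst R S \<sigma> C = cls S (subst \<sigma> (SOME p. cls R p = C))"

lemma subst_rel_ideal:
  assumes "\<And>l r. (l, r) \<in> R \<Longrightarrow> subst \<sigma> (l - r) \<in> rel_ideal S" "p \<in> rel_ideal R"
  shows "subst \<sigma> p \<in> rel_ideal S"
  using assms(2)
  by (induction rule: rel_ideal_induct)
    (simp_all add: assms(1) subst_zero subst_add subst_mult rel_ideal_zero rel_ideal_add
      rel_ideal_mult_left rel_ideal_mult_right)

lemma lift_subst_cls:
  assumes "\<And>l r. (l, r) \<in> R \<Longrightarrow> subst \<sigma> (l - r) \<in> rel_ideal S"
  shows "lift_subst R S \<sigma> (cls R p) = cls S (subst \<sigma> p)"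
proof -
  have "cls R (SOME r. cls R r = cls R p) = cls R p"
    by (rule someI) (rule refl)
  then show ?thesis
    using subst_rel_ideal[OF assms] by (simp add: lift_subst_def cls_eq_iff flip: subst_diff)
qed

lemma alg_isoI:
  assumes "\<And>p. f (cls R p) = h p" "bij_betw f (range (cls R)) (carrier B)"
    "\<And>p r. h (p * r) = h p \<otimes>\<^bsub>B\<^esub> h r" "\<And>p r. h (p + r) = h p \<oplus>\<^bsub>B\<^esub> h r"
    "\<And>c p. h (smul c p) = c \<odot>\<^bsub>B\<^esub> h p" "h 1 = \<one>\<^bsub>B\<^esub>"
  shows "f \<in> alg_iso (presented R) B"
  unfolding alg_iso_def
  by (auto intro!: ring_iso_memI simp: presented_simps presented_smult assms bij_betw_apply[OF assms(2), simplified assms(1)])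

text \<open>Both substitutions descend to the quotients. Their composites are determined on
  generators, so the induced maps are mutually inverse.\<close>

lemma lift_subst_alg_iso:
  assumes \<sigma>: "\<And>l r. (l, r) \<in> R \<Longrightarrow> subst \<sigma> (l - r) \<in> rel_ideal S"
    and \<tau>: "\<And>l r. (l, r) \<in> S \<Longrightarrow> subst \<tau> (l - r) \<in> rel_ideal R"
    and \<tau>\<sigma>: "\<And>g. subst \<tau> (\<sigma> g) = var g" and \<sigma>\<tau>: "\<And>g. subst \<sigma> (\<tau> g) = var g"
  shows "lift_subst R S \<sigma> \<in> alg_iso (presented R) (presented S)"
proof (rule alg_isoI[where h = "\<lambda>p. cls S (subst \<sigma> p)"])
  show "bij_betw (lift_subst R S \<sigma>) (range (cls R)) (carrier (presented S))"
    by (rule bij_betw_byWitness[where f' = "lift_subst S R \<tau>"])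
      (auto simp: presented_simps lift_subst_cls[OF \<sigma>] lift_subst_cls[OF \<tau>] subst_subst \<tau>\<sigma> \<sigma>\<tau> subst_ident)
qed (simp_all add: lift_subst_cls[OF \<sigma>] presented_simps presented_smult subst_simps)

lemma alg_iso_compose:
  assumes "f \<in> alg_iso A B" "g \<in> alg_iso B C"
  shows "(\<lambda>x. g (f x)) \<in> alg_iso A C"
proof -
  have f: "f \<in> ring_iso A B" "\<And>c x. x \<in> carrier A \<Longrightarrow> f (c \<odot>\<^bsub>A\<^esub> x) = c \<odot>\<^bsub>B\<^esub> f x"
    and g: "g \<in> ring_iso B C" "\<And>c x. x \<in> carrier B \<Longrightarrow> g (c \<odot>\<^bsub>B\<^esub> x) = c \<odot>\<^bsub>C\<^esub> g x"
    using assms by (auto simp: alg_iso_def)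
  have "g \<circ> f \<in> ring_iso A C"
    using f(1) g(1) by (rule ring_iso_set_trans)
  then show ?thesis
    using ring_iso_memE(1)[OF f(1)] f(2) g(2) by (simp add: alg_iso_def comp_def)
qed

section \<open>Generated subalgebras and their presentations\<close>

text \<open>The values of a homomorphism form a subalgebra, and \<open>falg_induct\<close> places
  each value in every subalgebra containing the generators.\<close>

lemma carrier_generated_subalgebra:
  "carrier (generated_subalgebra (presented S) (range (\<lambda>g. cls S (\<sigma> g)))) = range (\<lambda>p. cls S (subst \<sigma> p))"
proof -
  interpret ring "presented S" by (rule ring_presented)
  have minus: "\<ominus>\<^bsub>presented S\<^esub> cls S r = cls S (- r)" for r
    by (rule minus_equality) (auto simp: presented_simps)
  have "is_subalgebra (range (\<lambda>p. cls S (subst \<sigma> p))) (presented S)"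
    unfolding is_subalgebra_def
  proof (intro conjI allI ballI subringI)
    show "\<one>\<^bsub>presented S\<^esub> \<in> range (\<lambda>p. cls S (subst \<sigma> p))"
      unfolding presented_simps by (rule range_eqI[of _ _ 1]) (simp add: subst_one)
  next
    fix h1 h2 assume "h1 \<in> range (\<lambda>p. cls S (subst \<sigma> p))" "h2 \<in> range (\<lambda>p. cls S (subst \<sigma> p))"
    then obtain p r where h: "h1 = cls S (subst \<sigma> p)" "h2 = cls S (subst \<sigma> r)" by auto
    show "h1 \<otimes>\<^bsub>presented S\<^esub> h2 \<in> range (\<lambda>p. cls S (subst \<sigma> p))"
      unfolding h presented_simps by (rule range_eqI[of _ _ "p * r"]) (simp add: subst_mult)
    show "h1 \<oplus>\<^bsub>presented S\<^esub> h2 \<in> range (\<lambda>p. cls S (subst \<sigma> p))"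
      unfolding h presented_simps by (rule range_eqI[of _ _ "p + r"]) (simp add: subst_add)
  next
    fix c h assume "h \<in> range (\<lambda>p. cls S (subst \<sigma> p))"
    then obtain p where h: "h = cls S (subst \<sigma> p)" by auto
    show "c \<odot>\<^bsub>presented S\<^esub> h \<in> range (\<lambda>p. cls S (subst \<sigma> p))"
      unfolding h presented_smult by (rule range_eqI[of _ _ "smul c p"]) (simp add: subst_smul)
    show "\<ominus>\<^bsub>presented S\<^esub> h \<in> range (\<lambda>p. cls S (subst \<sigma> p))"
      unfolding h minus by (rule range_eqI[of _ _ "- p"]) (use subst_diff[of \<sigma> 0 p] in \<open>simp add: subst_zero\<close>)
  qed (auto simp: presented_simps)
  moreover have "range (\<lambda>g. cls S (\<sigma> g)) \<subseteq> range (\<lambda>p. cls S (subst \<sigma> p))"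
    by (auto intro: range_eqI[where x = "var _"] simp: subst_var)
  moreover have "cls S (subst \<sigma> p) \<in> H"
    if H: "is_subalgebra H (presented S)" "range (\<lambda>g. cls S (\<sigma> g)) \<subseteq> H" for H p
  proof -
    from H(1) have sub: "subring H (presented S)" and sm: "\<And>c x. x \<in> H \<Longrightarrow> c \<odot>\<^bsub>presented S\<^esub> x \<in> H"
      by (auto simp: is_subalgebra_def)
    note E = subringE(2,3)[OF sub, unfolded presented_simps]
    show ?thesis
    proof (induction p rule: falg_induct)
      case (add x y)
      then show ?case
        using subringE(7)[OF sub add] by (simp add: presented_simps subst_add)
    next
      case (smul c x)
      then show ?case
        using sm[OF smul, of c] by (simp add: presented_smult subst_smul)
    next
      case (var g x)
      have "cls S (\<sigma> g) \<in> H" using H(2) by auto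
      from subringE(6)[OF sub this var] show ?case
        by (simp add: presented_simps subst_mult subst_var)
    qed (simp_all add: E subst_simps)
  qed
  ultimately have "\<Inter>{H. is_subalgebra H (presented S) \<and> range (\<lambda>g. cls S (\<sigma> g)) \<subseteq> H}
      = range (\<lambda>p. cls S (subst \<sigma> p))"
    by (intro antisym Inter_greatest Inter_lower) auto
  then show ?thesis
    by (simp add: generated_subalgebra_def)
qed

lemma generated_subalgebra_simps [simp]:
  "x \<otimes>\<^bsub>generated_subalgebra A G\<^esub> y = x \<otimes>\<^bsub>A\<^esub> y" "\<one>\<^bsub>generated_subalgebra A G\<^esub> = \<one>\<^bsub>A\<^esub>"
  "x \<oplus>\<^bsub>generated_subalgebra A G\<^esub> y = x \<oplus>\<^bsub>A\<^esub> y" "c \<odot>\<^bsub>generated_subalgebra A G\<^esub> x = c \<odot>\<^bsub>A\<^esub> x"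
  by (simp_all add: generated_subalgebra_def)

text \<open>The first assumption makes the induced map well defined, the second makes it injective;
  \<open>carrier_generated_subalgebra\<close> gives surjectivity.\<close>

lemma generated_subalgebra_has_presentation:
  assumes \<sigma>: "\<And>l r. (l, r) \<in> R \<Longrightarrow> subst \<sigma> (l - r) \<in> rel_ideal S"
    and inj: "\<And>p. subst \<sigma> p \<in> rel_ideal S \<Longrightarrow> p \<in> rel_ideal R"
  shows "has_presentation (generated_subalgebra (presented S) (range (\<lambda>g. cls S (\<sigma> g)))) (\<lambda>g. cls S (\<sigma> g)) R"
proof -
  let ?B = "generated_subalgebra (presented S) (range (\<lambda>g. cls S (\<sigma> g)))"
  have "lift_subst R S \<sigma> \<in> alg_iso (presented R) ?B"
  proof (rule alg_isoI[where h = "\<lambda>p. cls S (subst \<sigma> p)"])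
    show "bij_betw (lift_subst R S \<sigma>) (range (cls R)) (carrier ?B)"
      unfolding carrier_generated_subalgebra
      by (rule bij_betw_imageI)
        (auto simp: inj_on_def image_image lift_subst_cls[OF \<sigma>] cls_eq_iff inj simp flip: subst_diff)
  qed (simp_all add: lift_subst_cls[OF \<sigma>] presented_simps presented_smult subst_simps)
  then show ?thesis
    unfolding has_presentation_def
    by (rule bexI[rotated]) (simp add: pgen_def lift_subst_cls[OF \<sigma>] subst_var)
qed

section \<open>The two presentations\<close>

lemma qbr_eq: "qbr q u v = smul (q / (q - inverse q)) (u * v) - smul (inverse q / (q - inverse q)) (v * u)"
  by (simp add: qbr_def scale_eq_smul smul.scale_right_diff_distrib)

text \<open>The relations are numbered so that the coefficients expressing one system through the
  other can be stated. Only the indices 0, 1, 2 are meaningful.\<close>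

definition vee_defect :: "'f::field \<Rightarrow> nat \<Rightarrow> ('f, vee_gen) falg" where
  "vee_defect q i =
    [qbr q (var Vyinv) (var Vx) - var Vyinv ^ 2,
     qbr q (var Vz) (var Vyinv) - var Vyinv ^ 2,
     qbr q (var Vz) (var Vx) - 1] ! i"

definition zZA_defect :: "'f::field \<Rightarrow> 'f \<Rightarrow> nat \<Rightarrow> ('f, zZA_gen) falg" where
  "zZA_defect q a i =
    [qbr q (var Gz) (var GA) - (smul a (var Gz ^ 2) + smul (inverse a) 1),
     qbr q (var GZ) (var GA) - (smul (inverse a) (var GZ ^ 2) + smul a 1),
     smul a (var Gz ^ 2)
       - smul ((inverse a * q - a * inverse q) / (q - inverse q)) (var Gz * var GZ)
       - smul ((a * q - inverse a * inverse q) / (q - inverse q)) (var GZ * var Gz)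
       + smul (inverse a) (var GZ ^ 2)] ! i"

lemma vee_defect_simps:
  "vee_defect q 0 = qbr q (var Vyinv) (var Vx) - var Vyinv ^ 2"
  "vee_defect q 1 = qbr q (var Vz) (var Vyinv) - var Vyinv ^ 2"
  "vee_defect q 2 = qbr q (var Vz) (var Vx) - 1"
  by (simp_all add: vee_defect_def)

lemma zZA_defect_simps:
  "zZA_defect q a 0 = qbr q (var Gz) (var GA) - (smul a (var Gz ^ 2) + smul (inverse a) 1)"
  "zZA_defect q a 1 = qbr q (var GZ) (var GA) - (smul (inverse a) (var GZ ^ 2) + smul a 1)"
  "zZA_defect q a 2 = smul a (var Gz ^ 2)
     - smul ((inverse a * q - a * inverse q) / (q - inverse q)) (var Gz * var GZ)
     - smul ((a * q - inverse a * inverse q) / (q - inverse q)) (var GZ * var Gz)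
     + smul (inverse a) (var GZ ^ 2)"
  by (simp_all add: zZA_defect_def)

lemma vee_rels_diff: "(l, r) \<in> vee_rels q \<Longrightarrow> \<exists>i\<in>{0, 1, 2}. l - r = vee_defect q i"
  by (auto simp: vee_rels_def vee_defect_simps[unfolded One_nat_def])

lemma zZA_rels_diff: "(l, r) \<in> zZA_rels q a \<Longrightarrow> \<exists>i\<in>{0, 1, 2}. l - r = zZA_defect q a i"
  unfolding zZA_rels_def scale_eq_smul
  by (auto simp: zZA_defect_simps[unfolded One_nat_def])

lemma vee_defect_rel_ideal: "i \<in> {0, 1, 2} \<Longrightarrow> vee_defect q i \<in> rel_ideal (vee_rels q)"
  by (auto intro!: rel_ideal_gen simp: vee_rels_def vee_defect_simps[unfolded One_nat_def]
      intro: rel_ideal_gen[where r = 1])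

lemma zZA_defect_rel_ideal:
  assumes "i \<in> {0, 1, 2}"
  shows "zZA_defect q a i \<in> rel_ideal (zZA_rels q a)"
proof -
  have "zZA_defect q a 2 - 0 \<in> rel_ideal (zZA_rels q a)"
    unfolding zZA_defect_simps by (rule rel_ideal_gen) (simp add: zZA_rels_def scale_eq_smul)
  moreover have "zZA_defect q a 0 \<in> rel_ideal (zZA_rels q a)" "zZA_defect q a 1 \<in> rel_ideal (zZA_rels q a)"
    unfolding zZA_defect_simps by (rule rel_ideal_gen, simp add: zZA_rels_def scale_eq_smul)+
  ultimately show ?thesis
    using assms by auto
qed

lemma rel_ideal_smul_iff: "c \<noteq> 0 \<Longrightarrow> smul c x \<in> rel_ideal R \<longleftrightarrow> x \<in> rel_ideal R"
  using rel_ideal_smul[of "smul c x" R "inverse c"] by (auto intro: rel_ideal_smul)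

section \<open>The linear change of generators and its inverse\<close>

definition phi :: "'f::field \<Rightarrow> zZA_gen \<Rightarrow> ('f, vee_gen) falg" where
  "phi a g = (case g of Gz \<Rightarrow> var Vz
     | GZ \<Rightarrow> smul (a^2) (var Vz) + smul (1 - a^2) (var Vyinv)
     | GA \<Rightarrow> smul (inverse a) (var Vx) + smul a (var Vz))"

definition psi :: "'f::field \<Rightarrow> vee_gen \<Rightarrow> ('f, zZA_gen) falg" where
  "psi a g = (case g of Vx \<Rightarrow> smul a (var GA) - smul (a^2) (var Gz)
     | Vyinv \<Rightarrow> smul (1 / (a - inverse a)) (smul a (var Gz) - smul (inverse a) (var GZ))
     | Vz \<Rightarrow> var Gz)"

lemma phi_simps [simp]:
  "phi a Gz = var Vz"
  "phi a GZ = smul (a^2) (var Vz) + smul (1 - a^2) (var Vyinv)"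
  "phi a GA = smul (inverse a) (var Vx) + smul a (var Vz)"
  by (simp_all add: phi_def)

lemma psi_simps [simp]:
  "psi a Vx = smul a (var GA) - smul (a^2) (var Gz)"
  "psi a Vyinv = smul (1 / (a - inverse a)) (smul a (var Gz) - smul (inverse a) (var GZ))"
  "psi a Vz = var Gz"
  by (simp_all add: psi_def)

lemma a_diff_inverse_nonzero: "a \<noteq> 0 \<Longrightarrow> a ^ 2 \<noteq> 1 \<Longrightarrow> a - inverse a \<noteq> 0" for a :: "'f::field"
  by (auto simp: field_simps power2_eq_square)

text \<open>An identity between linear combinations of fixed elements is checked coefficientwise, which
  turns it into a commutative identity in the field.\<close>

lemmas lookup_linear = lookup_smul lookup_add lookup_minus lookup_uminus

lemmas falg_expand = distrib_left distrib_right left_diff_distrib right_diff_distrib mult.assoc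
  mult_smul_left mult_smul_right

lemma phi_psi:
  assumes "a \<noteq> 0" "a ^ 2 \<noteq> 1"
  shows "subst (phi a) (psi a g) = var g" "subst (psi a) (phi a h) = var h"
proof -
  \<comment> \<open>With names for the inverses, each coefficient identity becomes polynomial,
    modulo \<open>b * (a - c) = 1\<close> and \<open>a * c = 1\<close>.\<close>
  define c where "c = inverse a"
  define b where "b = inverse (a - c)"
  have bc: "b * (a - c) = 1" "a * c = 1"
    using a_diff_inverse_nonzero[OF assms] assms(1) by (simp_all add: b_def c_def)
  note simps = phi_simps psi_simps subst_simps divide_inverse mult_1_left lookup_linear
    c_def[symmetric] b_def[symmetric]
  have "subst (phi a) (psi a Vx) = var Vx" "subst (phi a) (psi a Vyinv) = var Vyinv"
    "subst (psi a) (phi a GZ) = var GZ" "subst (psi a) (phi a GA) = var GA"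
    by (rule poly_mapping_eqI; simp only: simps; use bc in Groebner_Basis.algebra)+
  moreover have "subst (phi a) (psi a Vz) = var Vz" "subst (psi a) (phi a Gz) = var Gz"
    by (simp_all add: subst_simps)
  ultimately show "subst (phi a) (psi a g) = var g" "subst (psi a) (phi a h) = var h"
    by ((cases g; simp only:), (cases h; simp only:))
qed

context
  fixes q a :: "'f::field"
  assumes q: "q \<noteq> 0" "q - inverse q \<noteq> 0" and a: "a \<noteq> 0" "a ^ 2 \<noteq> 1"
begin

text \<open>The shape comes from bilinearity of the bracket, \<open>qbr q u u = u ^ 2\<close> and
  \<open>qbr q u v + qbr q v u = u * v + v * u\<close>. The first and third lines isolate defects 2
  and 1; the second then determines defect 0.\<close>

lemma subst_phi_zZA_defect:
  "subst (phi a) (zZA_defect q a 0) = smul (inverse a) (vee_defect q 2)" (is "?l1 = ?r1")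
  "subst (phi a) (zZA_defect q a 1)
   = smul a (vee_defect q 2) + smul ((1 - a^2) * inverse a) (vee_defect q 0)
     - smul (a * (1 - a^2)) (vee_defect q 1)" (is "?l2 = ?r2")
  "subst (phi a) (zZA_defect q a 2) = smul (- ((1 - a^2)^2) * inverse a) (vee_defect q 1)" (is "?l3 = ?r3")
proof -
  define r c where "r = inverse q" and "c = inverse a"
  define s where "s = inverse (q - r)"
  have src: "s * (q - r) = 1" "a * c = 1" "q * r = 1"
    using q a by (simp_all add: s_def r_def c_def)
  note simps = zZA_defect_simps vee_defect_simps qbr_eq subst_simps phi_simps power2_eq_square
    falg_expand divide_inverse s_def[symmetric] r_def[symmetric] c_def[symmetric] mult_1_right mult_1_left
  show "?l1 = ?r1" "?l2 = ?r2" "?l3 = ?r3"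
    by (rule poly_mapping_eqI, simp only: simps, simp only: lookup_linear,
        use src in Groebner_Basis.algebra)+
qed

lemma phi_rels: "(l, r) \<in> zZA_rels q a \<Longrightarrow> subst (phi a) (l - r) \<in> rel_ideal (vee_rels q)"
  using zZA_rels_diff[of l r q a] vee_defect_rel_ideal[of _ q]
  by (auto simp: subst_phi_zZA_defect[unfolded One_nat_def] rel_ideal_smul rel_ideal_add rel_ideal_diff rel_ideal_uminus)

text \<open>Since \<open>psi a\<close> inverts \<open>phi a\<close>, applying it to
  \<open>subst_phi_zZA_defect\<close> puts combinations of the images of the
  \<open>vee_defect\<close> elements into the ideal. Elimination in the order 2, 1, 0 divides by
  nonzero scalars only.\<close>

lemma psi_rels:
  assumes "(l, r) \<in> vee_rels q"
  shows "subst (psi a) (l - r) \<in> rel_ideal (zZA_rels q a)"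
proof -
  let ?I = "rel_ideal (zZA_rels q a)" and ?D = "\<lambda>i. subst (psi a) (vee_defect q i)"
  have inv: "subst (psi a) (subst (phi a) p) = p" for p
    by (simp add: subst_subst phi_psi[OF a] subst_ident)
  have psi: "subst (psi a) (subst (phi a) (zZA_defect q a i)) \<in> ?I" if "i \<in> {0, 1, 2}" for i
    unfolding inv using that by (rule zZA_defect_rel_ideal)
  have ne: "1 - a^2 \<noteq> 0" using a by simp
  have 2: "?D 2 \<in> ?I"
    using psi[of 0] a by (simp add: subst_phi_zZA_defect subst_simps rel_ideal_smul_iff)
  have 1: "?D 1 \<in> ?I"
    using psi[of 2] a ne
    by (simp add: subst_phi_zZA_defect subst_smul rel_ideal_smul_iff del: smul.scale_minus_left)
  have "smul a (?D 2) + smul ((1 - a^2) * inverse a) (?D 0) - smul (a * (1 - a^2)) (?D 1) \<in> ?I"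
    using psi[of 1] by (simp add: subst_phi_zZA_defect[unfolded One_nat_def] subst_simps)
  from rel_ideal_add[OF rel_ideal_diff[OF this rel_ideal_smul[OF 2, of a]] rel_ideal_smul[OF 1, of "a * (1 - a^2)"]]
  have "smul ((1 - a^2) * inverse a) (?D 0) \<in> ?I"
    by (simp add: algebra_simps del: smul.scale_scale)
  then have 0: "?D 0 \<in> ?I"
    using a ne by (subst (asm) rel_ideal_smul_iff) auto
  from vee_rels_diff[OF assms] show ?thesis
    using 0 1 2 by auto
qed

end

section \<open>The subalgebra generated by \<open>x\<close>, \<open>y\<^sup>-\<^sup>1\<close>, \<open>z\<close>\<close>

definition iota :: "vee_gen \<Rightarrow> ('f::field, uq_gen) falg" where
  "iota g = (case g of Vx \<Rightarrow> var Ux | Vyinv \<Rightarrow> var Uyinv | Vz \<Rightarrow> var Uz)"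

lemma iota_simps [simp]: "iota Vx = var Ux" "iota Vyinv = var Uyinv" "iota Vz = var Uz"
  by (simp_all add: iota_def)

lemma iota_rels:
  assumes "(l, r) \<in> vee_rels q"
  shows "subst iota (l - r) \<in> rel_ideal (uq_rels q)"
proof -
  let ?I = "rel_ideal (uq_rels q)" and ?s = "q / (q - inverse q)" and ?t = "inverse q / (q - inverse q)"
  let ?x = "var Ux :: ('a, uq_gen) falg" and ?w = "var Uyinv :: ('a, uq_gen) falg"
    and ?y = "var Uy :: ('a, uq_gen) falg" and ?z = "var Uz :: ('a, uq_gen) falg"
  have gens: "?y * ?w - 1 \<in> ?I" "?w * ?y - 1 \<in> ?I" "qbr q ?x ?y - 1 \<in> ?I" "qbr q ?y ?z - 1 \<in> ?I"
      "qbr q ?z ?x - 1 \<in> ?I"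
    by (rule rel_ideal_gen, simp add: uq_rels_def)+
  note intros = rel_ideal_add rel_ideal_diff rel_ideal_smul rel_ideal_mult_left rel_ideal_mult_right gens
  note simps = vee_defect_simps qbr_eq subst_simps iota_simps power2_eq_square
    falg_expand mult_1_right mult_1_left smul.scale_right_diff_distrib
  \<comment> \<open>The relation is multiplied by \<open>?w\<close> on both sides; the other two
    summands cancel \<open>?y\<close> against \<open>?w\<close>. The relation of y and z is treated
    in the same way.\<close>
  have "?w * (qbr q ?x ?y - 1) * ?w - smul ?s (?w * ?x * (?y * ?w - 1)) + smul ?t ((?w * ?y - 1) * ?x * ?w) \<in> ?I"
    by (intro intros)
  also have "?w * (qbr q ?x ?y - 1) * ?w - smul ?s (?w * ?x * (?y * ?w - 1)) + smul ?t ((?w * ?y - 1) * ?x * ?w)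
      = subst iota (vee_defect q 0)"
    by (simp add: simps)
  finally have 0: "subst iota (vee_defect q 0) \<in> ?I" .
  have "?w * (qbr q ?y ?z - 1) * ?w - smul ?s ((?w * ?y - 1) * ?z * ?w) + smul ?t (?w * ?z * (?y * ?w - 1)) \<in> ?I"
    by (intro intros)
  also have "?w * (qbr q ?y ?z - 1) * ?w - smul ?s ((?w * ?y - 1) * ?z * ?w) + smul ?t (?w * ?z * (?y * ?w - 1))
      = subst iota (vee_defect q 1)"
    by (simp only: simps) simp
  finally have 1: "subst iota (vee_defect q 1) \<in> ?I" .
  have 2: "subst iota (vee_defect q 2) \<in> ?I"
    using gens(5) by (simp add: vee_defect_simps qbr_eq subst_simps)
  from vee_rels_diff[OF assms] show ?thesis
    using 0 1 2 by auto
qed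

section \<open>A representation of U_q on formal monomials\<close>

type_synonym 'f pbw = "nat \<times> int \<times> nat \<Rightarrow>\<^sub>0 'f"

text \<open>
  Left multiplication by \<open>X = x - y\<^sup>-\<^sup>1\<close>, \<open>y\<^sup>-\<^sup>1\<close>, \<open>y\<close> and \<open>z - y\<^sup>-\<^sup>1\<close> on formal monomials, where \<open>(i, j, k)\<close>
  stands for \<open>X\<^sup>i (y\<^sup>-\<^sup>1)\<^sup>j (z - y\<^sup>-\<^sup>1)\<^sup>k\<close>. In \<open>opZ\<close> the truncated \<open>i - 1\<close> at \<open>i = 0\<close> is harmless, because
  its coefficient vanishes there.
\<close>

definition opX :: "'f::field pbw \<Rightarrow> 'f pbw" where
  "opX = lin_ext (\<lambda>(i, j, k). Poly_Mapping.single (Suc i, j, k) 1)"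

definition opW :: "'f::field \<Rightarrow> 'f pbw \<Rightarrow> 'f pbw" where
  "opW p = lin_ext (\<lambda>(i, j, k). Poly_Mapping.single (i, j + 1, k) (p ^ i))"

definition opY :: "'f::field \<Rightarrow> 'f pbw \<Rightarrow> 'f pbw" where
  "opY p = lin_ext (\<lambda>(i, j, k). Poly_Mapping.single (i, j - 1, k) (inverse p ^ i))"

definition opZ :: "'f::field \<Rightarrow> 'f pbw \<Rightarrow> 'f pbw" where
  "opZ p = lin_ext (\<lambda>(i, j, k).
     Poly_Mapping.single (i, j, Suc k) (p ^ i * p powi j)
     + Poly_Mapping.single (i - 1, j, k) (1 - p ^ i)
     + Poly_Mapping.single (i - 1, j + 2, k) ((p ^ i - 1) * p ^ (i - 1)))"

lemma linear_ops: "linear_op opX" "linear_op (opW p)" "linear_op (opY p)" "linear_op (opZ p)"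
  by (simp_all add: opX_def opW_def opY_def opZ_def linear_op_lin_ext)

lemmas ops_linear = linear_ops[THEN linear_op_add] linear_ops[THEN linear_op_smul]
  linear_ops[THEN linear_op_diff] linear_ops[THEN linear_op_zero]

lemma op_single:
  "opX (Poly_Mapping.single (i, j, k) c) = Poly_Mapping.single (Suc i, j, k) c"
  "opW p (Poly_Mapping.single (i, j, k) c) = Poly_Mapping.single (i, j + 1, k) (c * p ^ i)"
  "opY p (Poly_Mapping.single (i, j, k) c) = Poly_Mapping.single (i, j - 1, k) (c * inverse p ^ i)"
  "opZ p (Poly_Mapping.single (i, j, k) c) =
     Poly_Mapping.single (i, j, Suc k) (c * (p ^ i * p powi j))
     + Poly_Mapping.single (i - 1, j, k) (c * (1 - p ^ i))
     + Poly_Mapping.single (i - 1, j + 2, k) (c * ((p ^ i - 1) * p ^ (i - 1)))"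
  by (simp_all add: opX_def opW_def opY_def opZ_def smul.scale_right_distrib)

lemmas linear_op_intros = linear_op_id linear_op_plus linear_op_minus linear_op_scale
  linear_ops[THEN linear_op_compose] linear_ops

lemma lookup_single_coeff: "Poly_Mapping.lookup (Poly_Mapping.single k c) l = c * (1 when k = l)"
  for c :: "'f::field"
  by (simp add: lookup_single when_def)

lemma opW_opY:
  assumes "p \<noteq> 0"
  shows "opW p (opY p m) = m" "opY p (opW p m) = m"
proof -
  show "opW p (opY p m) = m"
    by (rule linear_op_ext) (use assms in \<open>auto intro!: linear_op_intros simp: op_single power_inverse\<close>)
  show "opY p (opW p m) = m"
    by (rule linear_op_ext) (use assms in \<open>auto intro!: linear_op_intros simp: op_single power_inverse\<close>)
qed

lemma opW_opX: "opW p (opX m) = smul p (opX (opW p m))"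
  by (rule linear_op_ext) (auto intro!: linear_op_intros simp: op_single)

lemma opZ_opW:
  assumes "p \<noteq> 0"
  shows "opZ p (opW p m) = smul p (opW p (opZ p m))"
proof (rule linear_op_ext[where f = "\<lambda>m. opZ p (opW p m)" and g = "\<lambda>m. smul p (opW p (opZ p m))"])
  fix t :: "nat \<times> int \<times> nat"
  obtain i j k where t: "t = (i, j, k)" by (cases t)
  show "opZ p (opW p (Poly_Mapping.single t 1)) = smul p (opW p (opZ p (Poly_Mapping.single t 1)))"
    using power_int_add[of p 1 j] assms unfolding t
    by (cases i) (simp_all add: op_single ops_linear smul.scale_right_distrib algebra_simps)
qed (intro linear_op_intros)+

text \<open>The two lower terms of \<open>opZ\<close> solve the recursion in \<open>i\<close>
  imposed by this relation, as in \<open>1 - p ^ Suc i = p * (1 - p ^ i) + (1 - p)\<close>.\<close>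

lemma opZ_opX:
  assumes "p \<noteq> 0"
  shows "opZ p (opX m) = smul p (opX (opZ p m)) + smul (1 - p) (m - opW p (opW p m))"
proof (rule linear_op_ext[where f = "\<lambda>m. opZ p (opX m)"
      and g = "\<lambda>m. smul p (opX (opZ p m)) + smul (1 - p) (m - opW p (opW p m))"])
  fix t :: "nat \<times> int \<times> nat"
  obtain i j k where t: "t = (i, j, k)" by (cases t)
  show "opZ p (opX (Poly_Mapping.single t 1)) = smul p (opX (opZ p (Poly_Mapping.single t 1)))
      + smul (1 - p) (Poly_Mapping.single t 1 - opW p (opW p (Poly_Mapping.single t 1)))"
    unfolding t
    by (cases i; rule poly_mapping_eqI)
      (simp_all add: op_single ops_linear lookup_linear lookup_single_coeff algebra_simps)
qed (intro linear_op_intros)+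

text \<open>Adding y^-1 recovers x and z from the shifted elements. Note that \<open>opW\<close>
  belongs to y^-1, while \<open>opZ\<close> belongs to z - y^-1, the element called \<open>W\<close>
  at the outset.\<close>

definition rep :: "'f::field \<Rightarrow> uq_gen \<Rightarrow> 'f pbw \<Rightarrow> 'f pbw" where
  "rep p g m = (case g of Ux \<Rightarrow> opX m + opW p m | Uy \<Rightarrow> opY p m | Uyinv \<Rightarrow> opW p m | Uz \<Rightarrow> opZ p m + opW p m)"

lemma rep_simps:
  "rep p Ux m = opX m + opW p m" "rep p Uy m = opY p m" "rep p Uyinv m = opW p m"
  "rep p Uz m = opZ p m + opW p m"
  by (simp_all add: rep_def)

lemma linear_op_rep: "linear_op (rep p g)"
  by (cases g) (simp_all add: rep_simps[abs_def] linear_ops linear_op_plus)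

section \<open>Reordering powers modulo a relation ideal\<close>

lemma power_commutation:
  assumes "u * v - smul c (v * u) \<in> rel_ideal R"
  shows "u * v ^ n - smul (c ^ n) (v ^ n * u) \<in> rel_ideal R"
proof (induction n)
  case (Suc n)
  have "u * v ^ Suc n - smul (c ^ Suc n) (v ^ Suc n * u)
      = (u * v - smul c (v * u)) * v ^ n + smul c (v * (u * v ^ n - smul (c ^ n) (v ^ n * u)))"
    by (simp add: algebra_simps smul.scale_right_diff_distrib)
  also have "\<dots> \<in> rel_ideal R"
    by (intro rel_ideal_add rel_ideal_mult_right rel_ideal_smul rel_ideal_mult_left assms Suc.IH)
  finally show ?case .
qed (simp add: rel_ideal_zero)

text \<open>Each passage of \<open>z\<close> past an \<open>x\<close> leaves a multiple of
  \<open>1 - w * w\<close>; moving this past the remaining powers, with factor \<open>p ^ 2\<close>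
  for \<open>w * w\<close>, makes the coefficients telescope. This accounts for the two lower terms
  of \<open>opZ\<close>.\<close>

lemma power_commutation_inhomogeneous:
  assumes WX: "w * x - smul p (x * w) \<in> rel_ideal R"
    and ZX: "z * x - smul p (x * z) - smul (1 - p) (1 - w * w) \<in> rel_ideal R"
  shows "z * x ^ Suc i - smul (p ^ Suc i) (x ^ Suc i * z)
     - smul (1 - p ^ Suc i) (x ^ i * (1 - smul (p ^ i) (w * w))) \<in> rel_ideal R"
proof (induction i)
  case 0
  then show ?case using ZX by simp
next
  case (Suc i)
  define y where "y = x ^ i"
  have "(w * w) * x - smul (p ^ 2) (x * (w * w))
      = w * (w * x - smul p (x * w)) + smul p ((w * x - smul p (x * w)) * w)"
    by (simp add: algebra_simps smul.scale_right_diff_distrib power2_eq_square)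
  also have "\<dots> \<in> rel_ideal R"
    by (intro rel_ideal_add rel_ideal_mult_right rel_ideal_smul rel_ideal_mult_left WX)
  finally have squares: "(w * w) * x ^ Suc i - smul ((p ^ 2) ^ Suc i) (x ^ Suc i * (w * w)) \<in> rel_ideal R"
    by (rule power_commutation)
  have "z * x ^ Suc (Suc i) - smul (p ^ Suc (Suc i)) (x ^ Suc (Suc i) * z)
     - smul (1 - p ^ Suc (Suc i)) (x ^ Suc i * (1 - smul (p ^ Suc i) (w * w)))
    = (z * x - smul p (x * z) - smul (1 - p) (1 - w * w)) * x ^ Suc i
      + smul p (x * (z * x ^ Suc i - smul (p ^ Suc i) (x ^ Suc i * z)
         - smul (1 - p ^ Suc i) (x ^ i * (1 - smul (p ^ i) (w * w)))))
      - smul (1 - p) ((w * w) * x ^ Suc i - smul ((p ^ 2) ^ Suc i) (x ^ Suc i * (w * w)))"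
    by (rule poly_mapping_eqI, simp only: power_Suc y_def[symmetric] power_mult_distrib power2_eq_square
        falg_expand mult_1_right mult_1_left, simp only: lookup_linear, Groebner_Basis.algebra)
  also have "\<dots> \<in> rel_ideal R"
    by (intro rel_ideal_add rel_ideal_diff rel_ideal_mult_right rel_ideal_smul rel_ideal_mult_left
        squares Suc.IH ZX)
  finally show ?case .
qed

text \<open>Abstracts the computation in \<open>rep_iota_pbw\<close>: \<open>y\<close>,
  \<open>v1\<close>, \<open>u1\<close> stand for powers of algebra elements and \<open>u\<close>,
  \<open>v\<close> for powers of \<open>p\<close>, which leaves a plain ring identity.\<close>

lemma reorder_identity:
  fixes x y w v1 z u1 :: "('f::field, 'g) falg"
  shows "smul (c * (p * u * v)) (x * y * v1 * (z * u1)) + smul (c * (1 - p * u)) (y * v1 * u1)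
      + smul (c * ((p * u - 1) * u)) (y * (w * (w * v1)) * u1) - z * smul c (x * y * v1 * u1)
    = smul (- c) ((z * (x * y) - smul (p * u) (x * y * z) - smul (1 - p * u) (y * (1 - smul u (w * w)))) * v1 * u1
        + smul (p * u) (x * y * (z * v1 - smul v (v1 * z)) * u1))"
  by (rule poly_mapping_eqI, simp only: falg_expand mult_1_right mult_1_left,
      simp only: lookup_linear, Groebner_Basis.algebra)

context
  fixes q p :: "'f::field"
  assumes q: "q \<noteq> 0" "q - inverse q \<noteq> 0"
  defines "p \<equiv> inverse q ^ 2"
begin

lemma p_nonzero: "p \<noteq> 0"
  using q by (simp add: p_def)

text \<open>Follows from \<open>opW_opX\<close> by applying \<open>opY\<close>, the inverse of
  \<open>opW\<close>, on both sides; \<open>opY_opZ\<close> comes from \<open>opZ_opW\<close>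
  likewise.\<close>

lemma opX_opY: "opX (opY p m) = smul p (opY p (opX m))"
proof -
  have "opY p (opW p (opX (opY p m))) = opY p (smul p (opX (opW p (opY p m))))"
    by (simp only: opW_opX)
  then show ?thesis
    by (simp add: opW_opY[OF p_nonzero] ops_linear)
qed

lemma opY_opZ: "opY p (opZ p m) = smul p (opZ p (opY p m))"
proof -
  have "opY p (opZ p (opW p (opY p m))) = opY p (smul p (opW p (opZ p (opY p m))))"
    by (simp only: opZ_opW[OF p_nonzero])
  then show ?thesis
    by (simp add: opW_opY[OF p_nonzero] ops_linear)
qed

text \<open>Elements annihilating every vector form a two-sided ideal, so the defining relations
  suffice. The vector stays arbitrary because right multiplication changes it.\<close>

lemma act_rep_rel_ideal: "u \<in> rel_ideal (uq_rels q) \<Longrightarrow> act (rep p) u m = 0"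
proof (induction arbitrary: m rule: rel_ideal_induct)
  case (gen l r)
  define c where "c = inverse q"
  define s where "s = inverse (q - c)"
  have sc: "s * (q - c) = 1" "q * c = 1"
    using q by (simp_all add: c_def s_def)
  have p: "p = c * c"
    by (simp add: p_def c_def power2_eq_square)
  note simps = act_diff act_one act_smul act_mult[OF linear_op_rep] act_var rep_simps ops_linear
    opW_opY[OF p_nonzero] opX_opY opY_opZ opW_opX opZ_opW[OF p_nonzero] opZ_opX[OF p_nonzero] qbr_eq
    divide_inverse c_def[symmetric] s_def[symmetric]
  from gen consider "l - r = var Uy * var Uyinv - 1" | "l - r = var Uyinv * var Uy - 1"
    | "l - r = qbr q (var Ux) (var Uy) - 1" | "l - r = qbr q (var Uy) (var Uz) - 1"
    | "l - r = qbr q (var Uz) (var Ux) - 1"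
    by (auto simp: uq_rels_def)
  then show ?case
  proof cases
    case 3
    show ?thesis unfolding 3
      by (rule poly_mapping_eqI, simp only: simps, simp only: lookup_linear lookup_zero p)
        (use sc in Groebner_Basis.algebra)
  next
    case 4
    show ?thesis unfolding 4
      by (rule poly_mapping_eqI, simp only: simps, simp only: lookup_linear lookup_zero p)
        (use sc in Groebner_Basis.algebra)
  next
    case 5
    show ?thesis unfolding 5
      by (rule poly_mapping_eqI, simp only: simps, simp only: lookup_linear lookup_zero p)
        (use sc in Groebner_Basis.algebra)
  qed (simp_all add: simps)
qed (simp_all add: act_zero act_add act_mult linear_op_rep linear_op_act[THEN linear_op_zero])

section \<open>Monomial expansion and injectivity of the map to U_q\<close>

abbreviation "vW \<equiv> var Vyinv :: ('f, vee_gen) falg"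
abbreviation "vX \<equiv> var Vx - var Vyinv :: ('f, vee_gen) falg"
abbreviation "vZ \<equiv> var Vz - var Vyinv :: ('f, vee_gen) falg"

text \<open>The shift by y^-1 absorbs the squares in the first two relations. The factor
  \<open>1 - p\<close>, written \<open>(q - c) * c\<close> in the proof, clears denominators and
  makes the leading coefficients 1.\<close>

lemma vee_commutation:
  "vW * vX - smul p (vX * vW) \<in> rel_ideal (vee_rels q)"
  "vZ * vW - smul p (vW * vZ) \<in> rel_ideal (vee_rels q)"
  "vZ * vX - smul p (vX * vZ) - smul (1 - p) (1 - vW * vW) \<in> rel_ideal (vee_rels q)"
proof -
  define c where "c = inverse q"
  define s where "s = inverse (q - c)"
  have sc: "s * (q - c) = 1" "q * c = 1"
    using q by (simp_all add: c_def s_def)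
  have p: "p = c * c"
    by (simp add: p_def c_def power2_eq_square)
  note simps = vee_defect_simps qbr_eq power2_eq_square falg_expand mult_1_right mult_1_left
    divide_inverse c_def[symmetric] s_def[symmetric]
  note intro = rel_ideal_smul[of _ "vee_rels q" "(q - c) * c"] rel_ideal_diff vee_defect_rel_ideal
  have "vW * vX - smul p (vX * vW) = smul ((q - c) * c) (vee_defect q 0)"
    "vZ * vW - smul p (vW * vZ) = smul ((q - c) * c) (vee_defect q 1)"
    "vZ * vX - smul p (vX * vZ) - smul (1 - p) (1 - vW * vW)
      = smul ((q - c) * c) (vee_defect q 2 - vee_defect q 1 - vee_defect q 0)"
    by (rule poly_mapping_eqI, simp only: simps, simp only: lookup_linear p,
        use sc in Groebner_Basis.algebra)+
  then show "vW * vX - smul p (vX * vW) \<in> rel_ideal (vee_rels q)"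
    "vZ * vW - smul p (vW * vZ) \<in> rel_ideal (vee_rels q)"
    "vZ * vX - smul p (vX * vZ) - smul (1 - p) (1 - vW * vW) \<in> rel_ideal (vee_rels q)"
    by (simp_all only:) (intro intro; simp)+
qed

text \<open>Evaluates a formal monomial in the free algebra, to be read modulo the relations. A
  negative \<open>j\<close> gets the default exponent 0; the expansion is claimed only on
  \<open>nonneg_keys\<close>.\<close>

definition pbw_monomial :: "nat \<times> int \<times> nat \<Rightarrow> ('f, vee_gen) falg" where
  "pbw_monomial t = (case t of (i, j, k) \<Rightarrow> vX ^ i * vW ^ nat j * vZ ^ k)"

text \<open>Spans a subspace stable under the operators for x, y^-1, z, though not under
  \<open>opY\<close>.\<close>

definition nonneg_keys :: "(nat \<times> int \<times> nat) set" where
  "nonneg_keys = {(i, j, k). j \<ge> 0}"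

text \<open>On monomials with a nonnegative power of \<open>y\<^sup>-\<^sup>1\<close> the representation describes left multiplication
  in the presented algebra.\<close>

lemma rep_iota_pbw:
  assumes "Poly_Mapping.keys m \<subseteq> nonneg_keys"
  shows "Poly_Mapping.keys (act (rep p) (iota g) m) \<subseteq> nonneg_keys \<and>
    lin_ext pbw_monomial (act (rep p) (iota g) m) - var g * lin_ext pbw_monomial m \<in> rel_ideal (vee_rels q)"
proof -
  let ?I = "rel_ideal (vee_rels q)" and ?\<Phi> = "lin_ext pbw_monomial"
  note \<Phi> = linear_op_lin_ext[of pbw_monomial]
  note \<Phi>_simps = linear_op_add[OF \<Phi>] linear_op_zero[OF \<Phi>]
  \<comment> \<open>This property is additive in the vector, and \<open>plus\<close> below adds
    operators, so the claim reduces to \<open>opX\<close>, \<open>opW\<close>, \<open>opZ\<close> on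
    single monomials.\<close>
  define good where "good f v m \<longleftrightarrow> Poly_Mapping.keys (f m) \<subseteq> nonneg_keys \<and> ?\<Phi> (f m) - v * ?\<Phi> m \<in> ?I" for f v m
  have extend: "good f v m"
    if f: "linear_op f" and "\<And>i j k c. good f v (Poly_Mapping.single (i, int j, k) c)" for f v
    using assms
  proof (induction rule: poly_mapping_induct_single)
    case zero
    then show ?case by (simp add: good_def linear_op_zero[OF f] \<Phi>_simps rel_ideal_zero)
  next
    case (single t c)
    then obtain i j k where "t = (i, j, k)" "j \<ge> 0"
      by (auto simp: nonneg_keys_def)
    then show ?case
      using that(2)[of i "nat j" k c] by simp
  next
    case (add x y)
    have eq: "?\<Phi> (f x + f y) - v * (?\<Phi> x + ?\<Phi> y) = (?\<Phi> (f x) - v * ?\<Phi> x) + (?\<Phi> (f y) - v * ?\<Phi> y)"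
      by (simp add: \<Phi>_simps algebra_simps)
    show ?case
      unfolding good_def linear_op_add[OF f] linear_op_add[OF \<Phi>, of x y] eq
      using add keys_add[of "f x" "f y"] by (auto simp: good_def rel_ideal_add)
  qed
  have X: "good opX vX m"
    by (rule extend[OF linear_ops(1)])
      (auto simp: good_def op_single nonneg_keys_def pbw_monomial_def mult.assoc rel_ideal_zero)
  have W: "good (opW p) vW m"
  proof (rule extend[OF linear_ops(2)])
    fix i j k c
    have "smul (c * p ^ i) (vX ^ i * (vW * vW ^ j) * vZ ^ k) - vW * smul c (vX ^ i * vW ^ j * vZ ^ k)
       = smul (-c) ((vW * vX ^ i - smul (p ^ i) (vX ^ i * vW)) * (vW ^ j * vZ ^ k))"
      by (simp add: left_diff_distrib[of "vW * vX ^ i"] smul.scale_right_diff_distrib mult.assoc)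
    also have "\<dots> \<in> ?I"
      by (intro rel_ideal_smul rel_ideal_mult_right power_commutation vee_commutation)
    finally show "good (opW p) vW (Poly_Mapping.single (i, int j, k) c)"
      by (simp add: good_def op_single nonneg_keys_def pbw_monomial_def nat_add_distrib)
  qed
  have Z: "good (opZ p) vZ m"
  proof (rule extend[OF linear_ops(4)])
    fix i j k c
    have keys: "Poly_Mapping.keys (opZ p (Poly_Mapping.single (i, int j, k) c)) \<subseteq> nonneg_keys"
      unfolding op_single by (intro order_trans[OF keys_add] Un_least) (auto simp: nonneg_keys_def)
    have ZW: "vZ * vW ^ j - smul (p ^ j) (vW ^ j * vZ) \<in> ?I"
      by (intro power_commutation vee_commutation)
    \<comment> \<open>The truncated \<open>i - 1\<close> calls for a case split: at
      \<open>i = 0\<close> the two lower terms of \<open>opZ\<close> vanish.\<close>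
    have "?\<Phi> (opZ p (Poly_Mapping.single (i, int j, k) c)) - vZ * ?\<Phi> (Poly_Mapping.single (i, int j, k) c) \<in> ?I"
    proof (cases i)
      case 0
      have "smul (c * p ^ j) (vW ^ j * (vZ * vZ ^ k)) - vZ * smul c (vW ^ j * vZ ^ k)
        = smul (-c) ((vZ * vW ^ j - smul (p ^ j) (vW ^ j * vZ)) * vZ ^ k)"
        by (simp add: left_diff_distrib[of "vZ * vW ^ j"] smul.scale_right_diff_distrib mult.assoc)
      also have "\<dots> \<in> ?I"
        by (intro rel_ideal_smul rel_ideal_mult_right ZW)
      finally show ?thesis
        by (simp add: 0 op_single \<Phi>_simps pbw_monomial_def)
    next
      case (Suc l)
      have nat: "nat (int j + 2) = Suc (Suc j)" by simp
      have "?\<Phi> (opZ p (Poly_Mapping.single (i, int j, k) c)) - vZ * ?\<Phi> (Poly_Mapping.single (i, int j, k) c)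
        = smul (c * (p * p ^ l * p ^ j)) (vX * vX ^ l * vW ^ j * (vZ * vZ ^ k)) + smul (c * (1 - p * p ^ l)) (vX ^ l * vW ^ j * vZ ^ k)
          + smul (c * ((p * p ^ l - 1) * p ^ l)) (vX ^ l * (vW * (vW * vW ^ j)) * vZ ^ k) - vZ * smul c (vX * vX ^ l * vW ^ j * vZ ^ k)"
        by (simp only: Suc op_single \<Phi>_simps pbw_monomial_def lin_ext_single prod.case nat nat_int
            diff_Suc_1 power_Suc power_int_of_nat)
      also have "\<dots> = smul (-c)
        ((vZ * (vX * vX ^ l) - smul (p * p ^ l) (vX * vX ^ l * vZ) - smul (1 - p * p ^ l) (vX ^ l * (1 - smul (p ^ l) (vW * vW)))) * vW ^ j * vZ ^ k
          + smul (p * p ^ l) (vX * vX ^ l * (vZ * vW ^ j - smul (p ^ j) (vW ^ j * vZ)) * vZ ^ k))"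
        by (rule reorder_identity)
      also have "\<dots> \<in> ?I"
        using power_commutation_inhomogeneous[OF vee_commutation(1,3), of l, unfolded power_Suc] ZW
        by (intro rel_ideal_smul rel_ideal_add rel_ideal_mult_right rel_ideal_mult_left)
      finally show ?thesis .
    qed
    with keys show "good (opZ p) vZ (Poly_Mapping.single (i, int j, k) c)"
      by (simp add: good_def)
  qed
  have plus: "good (\<lambda>m. f m + opW p m) (u + vW) m" if "good f u m" for f u
  proof -
    have eq: "?\<Phi> (f m + opW p m) - (u + vW) * ?\<Phi> m = (?\<Phi> (f m) - u * ?\<Phi> m) + (?\<Phi> (opW p m) - vW * ?\<Phi> m)"
      by (simp add: \<Phi>_simps algebra_simps)
    show ?thesis
      unfolding good_def eq
      using that W keys_add[of "f m" "opW p m"] by (auto simp: good_def rel_ideal_add)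
  qed
  have "good (act (rep p) (iota g)) (var g) m"
    using W plus[OF X] plus[OF Z] by (cases g) (simp_all add: good_def act_var rep_simps)
  then show ?thesis
    by (simp add: good_def)
qed

lemma iota_injective:
  assumes "subst iota u \<in> rel_ideal (uq_rels q)"
  shows "u \<in> rel_ideal (vee_rels q)"
proof -
  let ?I = "rel_ideal (vee_rels q)" and ?\<Phi> = "lin_ext pbw_monomial"
  let ?v = "Poly_Mapping.single (0, 0, 0) 1"
  let ?act = "act (\<lambda>g. act (rep p) (iota g))"
  note \<Phi> = linear_op_lin_ext[of pbw_monomial]
  note lin = linear_op_act[OF linear_op_rep]
  \<comment> \<open>Applied to the vector 1, \<open>u\<close> yields its own monomial expansion
    modulo the relations; \<open>rep_iota_pbw\<close> governs the prepending of a generator.\<close>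
  have "Poly_Mapping.keys (?act u ?v) \<subseteq> nonneg_keys \<and> ?\<Phi> (?act u ?v) - u \<in> ?I"
  proof (induction u rule: falg_induct)
    case zero
    then show ?case by (simp add: act_zero linear_op_zero[OF \<Phi>] rel_ideal_zero)
  next
    case one
    then show ?case by (simp add: act_one pbw_monomial_def nonneg_keys_def rel_ideal_zero)
  next
    case (add x y)
    then show ?case
      using keys_add[of "?act x ?v" "?act y ?v"] rel_ideal_add[of "?\<Phi> (?act x ?v) - x" "vee_rels q" "?\<Phi> (?act y ?v) - y"]
      by (auto simp: act_add linear_op_add[OF \<Phi>] algebra_simps)
  next
    case (smul c x)
    have "Poly_Mapping.keys (smul c (?act x ?v)) \<subseteq> Poly_Mapping.keys (?act x ?v)"
      by (auto simp: in_keys_iff lookup_smul)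
    with smul show ?case
      by (auto simp: act_smul linear_op_smul[OF \<Phi>] rel_ideal_smul simp flip: smul.scale_right_diff_distrib)
  next
    case (var g x)
    let ?m = "?act x ?v"
    have *: "?act (var g * x) ?v = act (rep p) (iota g) ?m"
      by (simp add: act_var_mult lin)
    have eq: "?\<Phi> (act (rep p) (iota g) ?m) - var g * x
      = (?\<Phi> (act (rep p) (iota g) ?m) - var g * ?\<Phi> ?m) + var g * (?\<Phi> ?m - x)"
      by (simp add: algebra_simps)
    then show ?case
      unfolding * eq using rep_iota_pbw[of ?m g] var by (blast intro: rel_ideal_add rel_ideal_mult_left)
  qed
  \<comment> \<open>By \<open>act_subst\<close> this is the action of \<open>subst iota u\<close>,
    which lies in the relation ideal of U_q. Hence \<open>0 - u\<close> lies in
    \<open>?I\<close>.\<close>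
  moreover have "?act u ?v = 0"
    using act_rep_rel_ideal[OF assms] by (simp add: act_subst linear_op_rep)
  ultimately show ?thesis
    using rel_ideal_uminus by (fastforce simp: linear_op_zero[OF \<Phi>])
qed

end

section \<open>Presentations of the subalgebra in both sets of generators\<close>

lemma uq_vee_eq: "Uq_vee q = generated_subalgebra (presented (uq_rels q)) (range (\<lambda>g. cls (uq_rels q) (iota g)))"
proof -
  have univ: "UNIV = {Vx, Vyinv, Vz}"
    by (auto intro: vee_gen.exhaust)
  have "range (\<lambda>g. cls (uq_rels q) (iota g)) = {cls (uq_rels q) (var Ux), cls (uq_rels q) (var Uyinv), cls (uq_rels q) (var Uz)}"
    unfolding univ by simp
  then show ?thesis
    by (simp add: Uq_vee_def Uq_def uq_x_def uq_yinv_def uq_z_def pgen_def)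
qed

lemma Uq_vee_presentation:
  assumes "q \<noteq> 0" "q - inverse q \<noteq> 0"
  shows "has_presentation (Uq_vee q)
    (\<lambda>g. case g of Vx \<Rightarrow> uq_x q | Vyinv \<Rightarrow> uq_yinv q | Vz \<Rightarrow> uq_z q) (vee_rels q)"
proof -
  have "(\<lambda>g. case g of Vx \<Rightarrow> uq_x q | Vyinv \<Rightarrow> uq_yinv q | Vz \<Rightarrow> uq_z q) = (\<lambda>g. cls (uq_rels q) (iota g))"
    by (simp add: fun_eq_iff uq_x_def uq_yinv_def uq_z_def pgen_def split: vee_gen.split)
  then show ?thesis
    unfolding uq_vee_eq
    using generated_subalgebra_has_presentation[OF iota_rels iota_injective[OF assms], of q] by simp
qed

text \<open>Isomorphisms compose; \<open>h\<close> is exposed so that the images of the new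
  generators can be computed in \<open>B\<close>.\<close>

lemma has_presentation_transfer:
  assumes B: "has_presentation B e S" and f: "f \<in> alg_iso (presented R) (presented S)"
  obtains h where "h \<in> alg_iso (presented S) B" "\<And>g. h (pgen S g) = e g"
    "has_presentation B (\<lambda>g. h (f (pgen R g))) R"
proof -
  from B obtain h where h: "h \<in> alg_iso (presented S) B" "\<And>g. h (pgen S g) = e g"
    by (auto simp: has_presentation_def)
  show ?thesis
    using h alg_iso_compose[OF f h(1)] by (intro that) (auto simp: has_presentation_def)
qed

theorem theorem10p19:
  fixes q a :: "'f::field"
  assumes "q \<noteq> 0" and "q ^ 4 \<noteq> 1" and "a \<noteq> 0" and "a ^ 2 \<noteq> 1"
  shows
    "has_presentation (Uq_vee q)
       (\<lambda>g. case g of Gz \<Rightarrow> uq_z q | GZ \<Rightarrow> uq_Z q a | GA \<Rightarrow> uq_A q a) (zZA_rels q a) \<and>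
     has_presentation (Uq_vee q)
       (\<lambda>g. case g of Vx \<Rightarrow> uq_x q | Vyinv \<Rightarrow> uq_yinv q | Vz \<Rightarrow> uq_z q) (vee_rels q) \<and>
     (let P = presented (zZA_rels q a); V = presented (vee_rels q);
          z = pgen (zZA_rels q a) Gz; Z = pgen (zZA_rels q a) GZ; A = pgen (zZA_rels q a) GA;
          x' = pgen (vee_rels q) Vx; yinv' = pgen (vee_rels q) Vyinv; z' = pgen (vee_rels q) Vz
      in \<exists>\<phi> \<in> alg_iso P V. \<exists>\<psi> \<in> alg_iso V P.
           (\<forall>p \<in> carrier P. \<psi> (\<phi> p) = p) \<and> (\<forall>v \<in> carrier V. \<phi> (\<psi> v) = v) \<and>
           \<phi> z = z' \<and>
           \<phi> Z = (a^2 \<odot>\<^bsub>V\<^esub> z') \<oplus>\<^bsub>V\<^esub> ((1 - a^2) \<odot>\<^bsub>V\<^esub> yinv') \<and>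
           \<phi> A = (inverse a \<odot>\<^bsub>V\<^esub> x') \<oplus>\<^bsub>V\<^esub> (a \<odot>\<^bsub>V\<^esub> z') \<and>
           \<psi> x' = (a \<odot>\<^bsub>P\<^esub> A) \<ominus>\<^bsub>P\<^esub> (a^2 \<odot>\<^bsub>P\<^esub> z) \<and>
           \<psi> yinv' = (1 / (a - inverse a)) \<odot>\<^bsub>P\<^esub> ((a \<odot>\<^bsub>P\<^esub> z) \<ominus>\<^bsub>P\<^esub> (inverse a \<odot>\<^bsub>P\<^esub> Z)) \<and>
           \<psi> z' = z)"
proof -
  \<comment> \<open>The bracket denominator is nonzero: \<open>q ^ 2 = 1\<close> would give
    \<open>q ^ 4 = 1\<close>.\<close>
  have q: "q - inverse q \<noteq> 0"
  proof
    assume "q - inverse q = 0"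
    then have "q * q = 1" using assms(1) by (simp add: field_simps)
    then have "q ^ 4 = 1" by (simp add: power4_eq_xxxx mult.assoc)
    with assms(2) show False by simp
  qed
  let ?R = "zZA_rels q a" and ?S = "vee_rels q"
  note phi = phi_rels[OF assms(1) q assms(3,4)] and psi = psi_rels[OF assms(1) q assms(3,4)]
  define \<phi> \<psi> where "\<phi> = lift_subst ?R ?S (phi a)" and "\<psi> = lift_subst ?S ?R (psi a)"
  have \<phi>: "\<phi> (cls ?R u) = cls ?S (subst (phi a) u)" for u
    unfolding \<phi>_def by (rule lift_subst_cls[OF phi])
  have \<psi>: "\<psi> (cls ?S v) = cls ?R (subst (psi a) v)" for v
    unfolding \<psi>_def by (rule lift_subst_cls[OF psi])
  note inv = phi_psi[OF assms(3,4)]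
  have iso: "\<phi> \<in> alg_iso (presented ?R) (presented ?S)" "\<psi> \<in> alg_iso (presented ?S) (presented ?R)"
    unfolding \<phi>_def \<psi>_def by (rule lift_subst_alg_iso; fact phi psi inv)+
  have \<phi>_gens: "\<phi> (pgen ?R Gz) = pgen ?S Vz"
    "\<phi> (pgen ?R GZ) = (a^2 \<odot>\<^bsub>presented ?S\<^esub> pgen ?S Vz) \<oplus>\<^bsub>presented ?S\<^esub> ((1 - a^2) \<odot>\<^bsub>presented ?S\<^esub> pgen ?S Vyinv)"
    "\<phi> (pgen ?R GA) = (inverse a \<odot>\<^bsub>presented ?S\<^esub> pgen ?S Vx) \<oplus>\<^bsub>presented ?S\<^esub> (a \<odot>\<^bsub>presented ?S\<^esub> pgen ?S Vz)"
    by (simp_all add: pgen_def \<phi> subst_var presented_smult presented_simps)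
  have \<psi>_gens: "\<psi> (pgen ?S Vx) = (a \<odot>\<^bsub>presented ?R\<^esub> pgen ?R GA) \<ominus>\<^bsub>presented ?R\<^esub> (a^2 \<odot>\<^bsub>presented ?R\<^esub> pgen ?R Gz)"
    "\<psi> (pgen ?S Vyinv) = (1 / (a - inverse a)) \<odot>\<^bsub>presented ?R\<^esub>
      ((a \<odot>\<^bsub>presented ?R\<^esub> pgen ?R Gz) \<ominus>\<^bsub>presented ?R\<^esub> (inverse a \<odot>\<^bsub>presented ?R\<^esub> pgen ?R GZ))"
    "\<psi> (pgen ?S Vz) = pgen ?R Gz"
    by (simp_all add: pgen_def \<psi> subst_var presented_smult presented_minus)
  have inverse: "\<psi> (\<phi> u) = u" if "u \<in> carrier (presented ?R)" for u
    using that by (auto simp: presented_simps \<phi> \<psi> subst_subst inv subst_ident)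
  have inverse': "\<phi> (\<psi> v) = v" if "v \<in> carrier (presented ?S)" for v
    using that by (auto simp: presented_simps \<phi> \<psi> subst_subst inv subst_ident)
  note pres = Uq_vee_presentation[OF assms(1) q]
  from has_presentation_transfer[OF pres iso(1)] obtain h where
    h: "h \<in> alg_iso (presented ?S) (Uq_vee q)"
      "\<And>g. h (pgen ?S g) = (case g of Vx \<Rightarrow> uq_x q | Vyinv \<Rightarrow> uq_yinv q | Vz \<Rightarrow> uq_z q)"
      "has_presentation (Uq_vee q) (\<lambda>g. h (\<phi> (pgen ?R g))) ?R"
    by blast
  have carrier: "pgen ?S g \<in> carrier (presented ?S)" "c \<odot>\<^bsub>presented ?S\<^esub> pgen ?S g \<in> carrier (presented ?S)" for g c
    by (simp_all add: pgen_def presented_smult presented_simps)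
  have h_smult: "h (c \<odot>\<^bsub>presented ?S\<^esub> pgen ?S g) = c \<odot>\<^bsub>Uq_vee q\<^esub> h (pgen ?S g)" for c g
    using h(1) carrier(1) by (auto simp: alg_iso_def)
  have h_add: "h (x \<oplus>\<^bsub>presented ?S\<^esub> y) = h x \<oplus>\<^bsub>Uq_vee q\<^esub> h y"
    if "x \<in> carrier (presented ?S)" "y \<in> carrier (presented ?S)" for x y
    using h(1) that by (auto simp: alg_iso_def ring_iso_memE(3))
  \<comment> \<open>Since \<open>h\<close> is a homomorphism, the linear expressions for the images
    under \<open>\<phi>\<close> turn into the definitions of \<open>uq_Z\<close> and
    \<open>uq_A\<close>.\<close>
  have "h (\<phi> (pgen ?R g)) = (case g of Gz \<Rightarrow> uq_z q | GZ \<Rightarrow> uq_Z q a | GA \<Rightarrow> uq_A q a)" for g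
    by (cases g) (simp_all add: \<phi>_gens h(2) h_add h_smult carrier uq_Z_def uq_A_def)
  with h(3) have "has_presentation (Uq_vee q)
       (\<lambda>g. case g of Gz \<Rightarrow> uq_z q | GZ \<Rightarrow> uq_Z q a | GA \<Rightarrow> uq_A q a) ?R"
    by simp
  with pres show ?thesis
    unfolding Let_def using iso inverse inverse' \<phi>_gens \<psi>_gens by blast
qed

end
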